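(* Let $L_n$ be as in the context. Then $\operatorname{Aut}(L_3)\cong L_3$ and $\operatorname{Out}(L_3)=1$, while for $n\ge 4$ $$\operatorname{Aut}(L_n)\cong\big(L_n\rtimes(\mathbb Z/2\mathbb Z)^{n-3}\big)\rtimes S_{n-2},\qquad \operatorname{Out}(L_n)\cong(\mathbb Z/2\mathbb Z)^{n-3}\rtimes S_{n-2}.$$
   Context: For $n\ge 2$, $L_n=\langle y_1,\dots,y_{n-1}\mid y_j^2=1\ (1\le j\le n-1),\ y_iy_{i+1}y_i=y_{i+1}y_iy_{i+1}\ (1\le i\le n-2)\rangle$ (no relations between $y_i,y_j$ with $|i-j|\ge 2$). $S_k$ is the symmetric group on $k$ letters. *)

theory Defs
  imports "HOL-Algebra.Sym_Groups" "HOL-Algebra.Elementary_Groups" "HOL-Algebra.Product_Groups" "HOL-Algebra.Bij"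
begin

text \<open>Since every generator y_j is an involution, L_n is presented as a monoid on the
letters 1..n-1 (letter j standing for y_j) modulo the relations y_j y_j = 1 and
y_i y_(i+1) y_i = y_(i+1) y_i y_(i+1). Elements of L_n are the equivalence classes of words.\<close>

definition Lstep :: "nat \<Rightarrow> nat list \<Rightarrow> nat list \<Rightarrow> bool" where
  "Lstep n u v \<longleftrightarrow>
     (\<exists>a b j. 1 \<le> j \<and> j \<le> n - 1 \<and> u = a @ [j, j] @ b \<and> v = a @ b) \<or>
     (\<exists>a b i. 1 \<le> i \<and> i \<le> n - 2 \<and> u = a @ [i, Suc i, i] @ b \<and> v = a @ [Suc i, i, Suc i] @ b)"

definition Lequiv :: "nat \<Rightarrow> nat list \<Rightarrow> nat list \<Rightarrow> bool" where
  "Lequiv n = (\<lambda>u v. Lstep n u v \<or> Lstep n v u)\<^sup>*\<^sup>*"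

definition Lclass :: "nat \<Rightarrow> nat list \<Rightarrow> nat list set" where
  "Lclass n w = {v. Lequiv n w v}"

definition Lgroup :: "nat \<Rightarrow> nat list set monoid" where
  "Lgroup n = \<lparr> carrier = Lclass n ` lists {1..n-1},
               mult = (\<lambda>A B. {w. \<exists>x\<in>A. \<exists>y\<in>B. Lequiv n (x @ y) w}),
               one = Lclass n [] \<rparr>"

definition Inn :: "('a, 'b) monoid_scheme \<Rightarrow> ('a \<Rightarrow> 'a) set" where
  "Inn G = {(\<lambda>x\<in>carrier G. g \<otimes>\<^bsub>G\<^esub> x \<otimes>\<^bsub>G\<^esub> inv\<^bsub>G\<^esub> g) | g. g \<in> carrier G}"

definition OutGroup :: "('a, 'b) monoid_scheme \<Rightarrow> ('a \<Rightarrow> 'a) set monoid" where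
  "OutGroup G = AutoGroup G Mod Inn G"

definition semidirect_product ::
  "('a, 'c) monoid_scheme \<Rightarrow> ('b, 'd) monoid_scheme \<Rightarrow> ('b \<Rightarrow> 'a \<Rightarrow> 'a) \<Rightarrow> ('a \<times> 'b) monoid" where
  "semidirect_product N H \<phi> =
     \<lparr> carrier = carrier N \<times> carrier H,
       mult = (\<lambda>p q. (fst p \<otimes>\<^bsub>N\<^esub> \<phi> (snd p) (fst q), snd p \<otimes>\<^bsub>H\<^esub> snd q)),
       one = (\<one>\<^bsub>N\<^esub>, \<one>\<^bsub>H\<^esub>) \<rparr>"

definition Z2pow :: "nat \<Rightarrow> (nat \<Rightarrow> int) monoid" where
  "Z2pow k = product_group {..<k} (\<lambda>_. integer_mod_group 2)"

end

theory Submission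
  imports Defs
begin

text \<open>With \<open>t = y\<^sub>1\<close>, the relations of \<open>L\<^sub>n\<close> can be rewritten in terms of \<open>t\<close> and \<open>k = n - 2\<close>
  elements \<open>a\<^sub>i\<close> of order three inverted by \<open>t\<close>, where \<open>y\<^sub>i\<close> is the conjugate of \<open>t\<close> by
  \<open>a\<^sub>1 \<dots> a\<^sub>i\<^sub>-\<^sub>1\<close>. So \<open>L\<^sub>n\<close> is the free product of \<open>k\<close> copies of \<open>\<int>/3\<close>, extended by an
  involution \<open>t\<close> inverting each \<open>a\<^sub>i\<close>. In reduced words, an element \<open>w t\<close> is an
  involution iff \<open>w\<close> is a palindrome, and then it is conjugate to \<open>t\<close>; so every automorphism is
  inner up to one that fixes \<open>t\<close>. The latter sends \<open>a\<^sub>i\<close> to an element of order three inverted by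
  \<open>t\<close>, and this is again a palindrome, of length one, so it is some \<open>a\<^sub>j\<close> or its inverse. Hence
  the automorphisms fixing \<open>t\<close> are the signed permutations of the \<open>a\<^sub>i\<close>, and among these only the
  identity and the simultaneous inversion (conjugation by \<open>t\<close>) are inner.\<close>

section \<open>Free products of cyclic groups of order three with an inverting involution\<close>

text \<open>Palindromes and lengths make sense only once the word problem is solved. Therefore the
  extended free product is modelled by reduced words with an explicit multiplication, and the
  presented group is matched with this model through two mutually inverse homomorphisms. An
  involution \<open>w t\<close> is conjugate to \<open>t\<close> because every letter is a square in
  Z/3: the middle letter of a reduced palindrome can be split evenly between both halves.

  The sign changes form (Z/2)^k with k = n - 2, and the simultaneous one is inner, which leaves the
  exponent k - 1 = n - 3. A complement of this diagonal has to be chosen, and for even k none is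
  invariant under all permutations of the coordinates. So the permutations normalise the chosen
  complement only modulo inner automorphisms. This is why S_k acts on the whole extension of
  \<open>L\<close> by the sign changes, and why the abstract decomposition asks for conjugates only
  modulo a normal subgroup.\<close>

text \<open>The letter \<open>(i, False)\<close> stands for the generator \<open>a\<^sub>i\<close> and \<open>(i, True)\<close> for its inverse; the
  product of two equal letters is therefore the opposite letter. An element \<open>(w, s)\<close> of \<open>KG k\<close>
  stands for \<open>w t\<^sup>s\<close>.\<close>

type_synonym letter = "nat \<times> bool"

text \<open>On a reduced word one reduction suffices: a merged letter keeps its index, which differs
  from that of the next letter, and a cancellation exposes a tail that was reduced already.\<close>

fun redcons :: "letter \<Rightarrow> letter list \<Rightarrow> letter list" where
  "redcons l [] = [l]"
| "redcons l (m # w) = (if fst l \<noteq> fst m then l # m # w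
     else if l = m then (fst l, \<not> snd l) # w else w)"

definition wmult :: "letter list \<Rightarrow> letter list \<Rightarrow> letter list" where
  "wmult u v = foldr redcons u v"

definition flip :: "bool \<Rightarrow> letter \<Rightarrow> letter" where
  "flip s l = (fst l, snd l \<noteq> s)"

definition winv :: "letter list \<Rightarrow> letter list" where
  "winv w = rev (map (flip True) w)"

definition rwords :: "nat \<Rightarrow> letter list set" where
  "rwords k = {w. distinct_adj (map fst w) \<and> fst ` set w \<subseteq> {1..k}}"

definition KG :: "nat \<Rightarrow> (letter list \<times> bool) monoid" where
  "KG k = \<lparr> carrier = rwords k \<times> UNIV,
     mult = (\<lambda>x y. (wmult (fst x) (map (flip (snd x)) (fst y)), snd x \<noteq> snd y)),
     one = ([], False) \<rparr>"

lemma fst_flip [simp]: "fst (flip s l) = fst l" and snd_flip [simp]: "snd (flip s l) = (snd l \<noteq> s)"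
  by (auto simp: flip_def)

lemma flip_False [simp]: "flip False = id" "flip False l = l"
  by (auto simp: flip_def)

lemma fst_comp_flip [simp]: "fst \<circ> flip s = fst"
  by auto

lemma flip_flip [simp]: "flip s (flip r l) = flip (s \<noteq> r) l"
  by (auto simp: flip_def)

lemma flip_comp [simp]: "flip s \<circ> flip r = flip (s \<noteq> r)"
  by auto

lemma flip_True_neq [simp]: "flip True l \<noteq> l" "l \<noteq> flip True l"
  by (auto simp: flip_def prod_eq_iff)

section \<open>Multiplication of reduced words\<close>

lemma wmult_Nil [simp]: "wmult [] v = v"
  and wmult_Cons [simp]: "wmult (l # u) v = redcons l (wmult u v)"
  and wmult_append: "wmult (u @ v) w = wmult u (wmult v w)"
  by (auto simp: wmult_def)

lemma rwords_Nil [simp]: "[] \<in> rwords k"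
  by (simp add: rwords_def)

lemma rwords_Cons: "l # w \<in> rwords k \<longleftrightarrow>
    fst l \<in> {1..k} \<and> w \<in> rwords k \<and> (w = [] \<or> fst l \<noteq> fst (hd w))"
  by (cases w) (auto simp: rwords_def)

lemma rwords_append: "u @ v \<in> rwords k \<longleftrightarrow>
    u \<in> rwords k \<and> v \<in> rwords k \<and> (u = [] \<or> v = [] \<or> fst (last u) \<noteq> fst (hd v))"
  by (auto simp: rwords_def distinct_adj_append_iff last_map hd_map)

lemma rwords_rev [simp]: "rev w \<in> rwords k \<longleftrightarrow> w \<in> rwords k"
  by (simp add: rwords_def flip: rev_map)

lemma rwords_flip [simp]: "map (flip s) w \<in> rwords k \<longleftrightarrow> w \<in> rwords k"
  by (simp add: rwords_def image_image)

lemma redcons_closed [simp]: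
  assumes "w \<in> rwords k" "fst l \<in> {1..k}" shows "redcons l w \<in> rwords k"
  using assms by (cases w) (auto simp: rwords_Cons)

lemma wmult_closed [simp]:
  assumes "u \<in> rwords k" "v \<in> rwords k" shows "wmult u v \<in> rwords k"
  using assms by (induction u) (auto simp: rwords_Cons)

lemma redcons_reduced: "w = [] \<or> fst l \<noteq> fst (hd w) \<Longrightarrow> redcons l w = l # w"
  by (cases w) auto

text \<open>Together with \<open>redcons_twice\<close> this says that the operators
  \<open>redcons l\<close> make the free product of copies of Z/3 act on reduced words. The check is
  local, because reducedness controls the letter that becomes the new neighbour.\<close>

lemma redcons_inverse:
  assumes "w \<in> rwords k" shows "redcons l (redcons (flip True l) w) = w"
  using assms
  by (cases w; cases l) (auto simp: rwords_Cons flip_def prod_eq_iff redcons_reduced)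

lemma redcons_twice:
  assumes "w \<in> rwords k" shows "redcons l (redcons l w) = redcons (flip True l) w"
  using assms
  by (cases w; cases l) (auto simp: rwords_Cons flip_def prod_eq_iff redcons_reduced)

text \<open>Van der Waerden's argument: merging or cancelling at the head of \<open>v\<close> costs
  one use of the operator identity \<open>redcons_twice\<close> or \<open>redcons_inverse\<close>.
  Associativity is then an induction over the left factor.\<close>

lemma wmult_redcons:
  assumes "v \<in> rwords k" "w \<in> rwords k"
  shows "wmult (redcons l v) w = redcons l (wmult v w)"
proof (cases v)
  case (Cons m v')
  then have v': "v' \<in> rwords k" "wmult v' w \<in> rwords k" using assms by (auto simp: rwords_Cons)
  consider "fst l \<noteq> fst m" | "l = m" | "l = flip True m"
    by (cases l; cases m) (auto simp: flip_def)
  then show ?thesis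
  proof cases
    case 2
    then show ?thesis using redcons_twice[OF v'(2), of m] Cons by (simp add: flip_def)
  next
    case 3
    then show ?thesis using redcons_inverse[OF v'(2), of "flip True m"] Cons by simp
  qed (use Cons in auto)
qed simp

lemma wmult_assoc:
  assumes "u \<in> rwords k" "v \<in> rwords k" "w \<in> rwords k"
  shows "wmult (wmult u v) w = wmult u (wmult v w)"
  using assms(1)
proof (induction u)
  case (Cons l u)
  then have "wmult u v \<in> rwords k" using assms by (simp add: rwords_Cons)
  with Cons show ?case by (simp add: wmult_redcons[OF _ assms(3)] rwords_Cons)
qed simp

lemma wmult_reduced:
  assumes "u @ v \<in> rwords k" shows "wmult u v = u @ v"
  using assms
proof (induction u)
  case (Cons l u)
  then show ?case by (cases "u @ v") (auto simp: rwords_Cons)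
qed simp

lemma wmult_Nil_right: "u \<in> rwords k \<Longrightarrow> wmult u [] = u"
  using wmult_reduced[of u "[]" k] by simp

lemma winv_closed [simp]: "winv w \<in> rwords k \<longleftrightarrow> w \<in> rwords k"
  by (simp add: winv_def)

lemma wmult_winv: "wmult (winv w) w = []"
  by (induction w) (auto simp: winv_def wmult_append)

section \<open>Signed permutations of the letters\<close>

definition sperm :: "(nat \<Rightarrow> nat) \<Rightarrow> (nat \<Rightarrow> bool) \<Rightarrow> letter \<Rightarrow> letter" where
  "sperm \<sigma> \<epsilon> l = (\<sigma> (fst l), snd l \<noteq> \<epsilon> (fst l))"

lemma sperm_flip [simp]: "sperm \<sigma> \<epsilon> (flip s l) = flip s (sperm \<sigma> \<epsilon> l)"
  by (auto simp: sperm_def flip_def)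

text \<open>Inverting all letters is a signed permutation, so the twist in the product of
  \<open>KG k\<close> and the later automorphisms \<open>saut\<close> share one proof of
  multiplicativity.\<close>

lemma flip_eq_sperm: "flip s = sperm id (\<lambda>_. s)"
  by (auto simp: sperm_def flip_def)

text \<open>Injectivity keeps different indices different, so \<open>redcons\<close> takes the same
  branch before and after relabelling.\<close>

lemma redcons_sperm:
  assumes "inj \<sigma>"
  shows "map (sperm \<sigma> \<epsilon>) (redcons l w) = redcons (sperm \<sigma> \<epsilon> l) (map (sperm \<sigma> \<epsilon>) w)"
proof (cases w)
  case (Cons m w')
  then show ?thesis using assms by (cases l; cases m) (auto simp: sperm_def inj_eq)
qed simp

lemma wmult_sperm:
  assumes "inj \<sigma>"
  shows "map (sperm \<sigma> \<epsilon>) (wmult u v) = wmult (map (sperm \<sigma> \<epsilon>) u) (map (sperm \<sigma> \<epsilon>) v)"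
  by (induction u) (auto simp: redcons_sperm assms)

lemma wmult_flip: "map (flip s) (wmult u v) = wmult (map (flip s) u) (map (flip s) v)"
  by (simp add: flip_eq_sperm wmult_sperm)

lemma rwords_sperm:
  assumes "\<sigma> permutes {1..k}" "w \<in> rwords k"
  shows "map (sperm \<sigma> \<epsilon>) w \<in> rwords k"
proof -
  have inj: "inj \<sigma>" using assms(1) by (rule permutes_inj)
  have "fst \<circ> sperm \<sigma> \<epsilon> = \<sigma> \<circ> fst" by (auto simp: sperm_def)
  then have "map fst (map (sperm \<sigma> \<epsilon>) w) = map \<sigma> (map fst w)" by simp
  moreover have "distinct_adj (map \<sigma> (map fst w))"
    using assms(2) inj by (auto simp: rwords_def simp del: map_map intro!: distinct_adj_mapI intro: inj_on_subset)
  moreover have "fst ` set (map (sperm \<sigma> \<epsilon>) w) = \<sigma> ` fst ` set w"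
    by (simp add: image_image sperm_def)
  moreover have "\<sigma> ` fst ` set w \<subseteq> {1..k}"
    using assms permutes_image[OF assms(1)] by (auto simp: rwords_def)
  ultimately show ?thesis by (simp only: rwords_def mem_Collect_eq simp_thms)
qed

section \<open>The extended free product and its universal property\<close>

lemma KG_carrier: "x \<in> carrier (KG k) \<longleftrightarrow> fst x \<in> rwords k"
  by (cases x) (auto simp: KG_def)

lemma KG_mult: "(u, s) \<otimes>\<^bsub>KG k\<^esub> (v, r) = (wmult u (map (flip s) v), s \<noteq> r)"
  by (simp add: KG_def)

lemma KG_one: "\<one>\<^bsub>KG k\<^esub> = ([], False)"
  by (simp add: KG_def)

lemma map_flip_True_winv: "map (flip True) (winv w) = rev w"
  by (simp add: winv_def rev_map comp_def)

lemma group_KG: "group (KG k)"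
proof (rule groupI)
  fix x y z assume "x \<in> carrier (KG k)" "y \<in> carrier (KG k)" "z \<in> carrier (KG k)"
  then show "x \<otimes>\<^bsub>KG k\<^esub> y \<otimes>\<^bsub>KG k\<^esub> z = x \<otimes>\<^bsub>KG k\<^esub> (y \<otimes>\<^bsub>KG k\<^esub> z)"
    by (cases x; cases y; cases z)
       (auto simp: KG_carrier KG_mult wmult_flip intro!: wmult_assoc[of _ k])
next
  fix x assume "x \<in> carrier (KG k)"
  then show "\<exists>y\<in>carrier (KG k). y \<otimes>\<^bsub>KG k\<^esub> x = \<one>\<^bsub>KG k\<^esub>"
    \<comment> \<open>The inverse of \<open>w t^s\<close> is \<open>t^s w^-1\<close>, and moving
      \<open>t^s\<close> to the right flips the letters of \<open>w^-1\<close>.\<close>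
    by (cases x, intro bexI[of _ "(map (flip (snd x)) (winv (fst x)), snd x)"])
       (auto simp: KG_carrier KG_mult KG_one wmult_winv simp flip: wmult_flip)
qed (auto simp: KG_carrier KG_mult KG_one)

lemma KG_inv:
  assumes "w \<in> rwords k"
  shows "inv\<^bsub>KG k\<^esub> (w, s) = (map (flip s) (winv w), s)"
  by (rule group.inv_equality[OF group_KG])
     (use assms in \<open>auto simp: KG_carrier KG_mult KG_one wmult_winv simp flip: wmult_flip\<close>)

context group
begin

definition letter_val :: "(nat \<Rightarrow> 'a) \<Rightarrow> letter \<Rightarrow> 'a" where
  "letter_val a l = (if snd l then inv a (fst l) else a (fst l))"

definition word_val :: "('c \<Rightarrow> 'a) \<Rightarrow> 'c list \<Rightarrow> 'a" where
  "word_val f w = foldr (\<lambda>l x. f l \<otimes> x) w \<one>"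

lemma word_val_simps [simp]: "word_val f [] = \<one>" "word_val f (l # w) = f l \<otimes> word_val f w"
  by (auto simp: word_val_def)

lemma word_val_closed:
  "(\<And>l. l \<in> set w \<Longrightarrow> f l \<in> carrier G) \<Longrightarrow> word_val f w \<in> carrier G"
  by (induction w) auto

lemma word_val_append:
  assumes "\<And>l. l \<in> set u \<union> set v \<Longrightarrow> f l \<in> carrier G"
  shows "word_val f (u @ v) = word_val f u \<otimes> word_val f v"
  using assms by (induction u) (auto simp: word_val_closed m_assoc)

text \<open>Evaluating a word letter by letter and then multiplying by the power of \<open>t\<close>
  respects the product of \<open>KG k\<close>: reductions use only that the cubes are trivial, the
  twist only that \<open>t\<close> inverts each \<open>a i\<close>. Together with
  \<open>KG_hom_eq\<close> this identifies \<open>KG k\<close> as the group presented by these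
  relations.\<close>

lemma KG_hom_exists:
  assumes a: "\<And>i. i \<in> {1..k} \<Longrightarrow> a i \<in> carrier G" "\<And>i. i \<in> {1..k} \<Longrightarrow> a i \<otimes> a i \<otimes> a i = \<one>"
    and t: "t \<in> carrier G" "t \<otimes> t = \<one>" "\<And>i. i \<in> {1..k} \<Longrightarrow> t \<otimes> a i \<otimes> t = inv a i"
  obtains h where "h \<in> hom (KG k) G" "h ([], True) = t"
    "\<And>i. i \<in> {1..k} \<Longrightarrow> h ([(i, False)], False) = a i"
proof -
  let ?f = "letter_val a" and ?v = "word_val (letter_val a)" and ?t = "\<lambda>s. if s then t else \<one>"
  have f: "?f l \<in> carrier G" if "fst l \<in> {1..k}" for l
    using that a by (auto simp: letter_val_def)
  have v: "?v w \<in> carrier G" if "w \<in> rwords k" for w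
    by (rule word_val_closed) (use that f in \<open>auto simp: rwords_def\<close>)
  have a_sq: "a i \<otimes> a i = inv a i" if "i \<in> {1..k}" for i
    using a[OF that] by (metis inv_equality m_closed r_inv_ex inv_unique' l_inv)
  have f_flip: "?f (flip True l) = inv ?f l" if "fst l \<in> {1..k}" for l
    using that a by (auto simp: letter_val_def)
  have f_sq: "?f l \<otimes> ?f l = inv ?f l" if "fst l \<in> {1..k}" for l
    using that a a_sq[OF that] by (auto simp: letter_val_def simp flip: inv_mult_group)
  \<comment> \<open>Merging corresponds to the square of a letter being its inverse, cancelling to
    the inverse law.\<close>
  have v_redcons: "?v (redcons l w) = ?f l \<otimes> ?v w" if "fst l \<in> {1..k}" "w \<in> rwords k" for l w
  proof (cases w)
    case (Cons m w')
    with that have m: "fst m \<in> {1..k}" "w' \<in> rwords k" by (auto simp: rwords_Cons)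
    consider "fst l \<noteq> fst m" | "l = m" | "l = flip True m"
      by (cases l; cases m) (auto simp: flip_def)
    then show ?thesis
    proof cases
      case 2
      then have "redcons l w = flip True l # w'" using Cons by (simp add: flip_def)
      then show ?thesis
        using 2 Cons m f[OF m(1)] v[OF m(2)] by (simp add: f_flip f_sq flip: m_assoc)
    next
      case 3
      then show ?thesis
        using Cons m f[OF m(1)] v[OF m(2)] by (simp add: f_flip flip: m_assoc)
    qed (use Cons in auto)
  qed simp
  have v_wmult: "?v (wmult u w) = ?v u \<otimes> ?v w" if "u \<in> rwords k" "w \<in> rwords k" for u w
    using that(1)
  proof (induction u)
    case (Cons l u)
    then have "fst l \<in> {1..k}" "u \<in> rwords k" by (auto simp: rwords_Cons)
    then show ?case using Cons that f v by (simp add: v_redcons m_assoc)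
  qed (use that v in simp)
  have t_f: "t \<otimes> ?f l = ?f (flip True l) \<otimes> t" if "fst l \<in> {1..k}" for l
  proof -
    have *: "t \<otimes> a (fst l) = inv a (fst l) \<otimes> t"
      using t that a(1)[OF that] by (metis m_assoc m_closed r_one)
    then have "a (fst l) \<otimes> t = t \<otimes> inv a (fst l)"
      using t that a(1)[OF that]
      by (metis inv_closed inv_solve_left inv_solve_right m_assoc m_closed)
    with * show ?thesis by (auto simp: letter_val_def)
  qed
  \<comment> \<open>Carrying \<open>t\<close> past a word inverts each of its letters, which is the
    flip in the product of \<open>KG k\<close>.\<close>
  have t_v: "t \<otimes> ?v w = ?v (map (flip True) w) \<otimes> t" if "w \<in> rwords k" for w
    using that
  proof (induction w)
    case (Cons l w)
    then have l: "fst l \<in> {1..k}" "w \<in> rwords k" by (auto simp: rwords_Cons)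
    have "t \<otimes> ?v (l # w) = (t \<otimes> ?f l) \<otimes> ?v w"
      using l t f v by (simp add: m_assoc)
    also have "\<dots> = ?f (flip True l) \<otimes> (t \<otimes> ?v w)"
      using l t f v by (simp add: m_assoc t_f)
    also have "\<dots> = ?v (map (flip True) (l # w)) \<otimes> t"
      using l t f v Cons by (simp add: m_assoc)
    finally show ?case .
  qed (use t in simp)
  have t_v': "?t s \<otimes> ?v w = ?v (map (flip s) w) \<otimes> ?t s" if "w \<in> rwords k" for w s
    using that t_v v by auto
  have t_t: "?t s \<otimes> ?t r = ?t (s \<noteq> r)" for s r
    using t by auto
  have t_c: "?t s \<in> carrier G" for s using t by auto
  define h where "h x = ?v (fst x) \<otimes> ?t (snd x)" for x
  show ?thesis
  proof (rule that)
    show "h \<in> hom (KG k) G"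
    proof (rule homI)
      fix x assume "x \<in> carrier (KG k)"
      then show "h x \<in> carrier G" unfolding h_def KG_carrier using v t_c by blast
    next
      fix x y assume *: "x \<in> carrier (KG k)" "y \<in> carrier (KG k)"
      obtain u s w r where xy: "x = (u, s)" "y = (w, r)" by (cases x; cases y)
      have c: "u \<in> rwords k" "w \<in> rwords k" "map (flip s) w \<in> rwords k"
        using * xy by (auto simp: KG_carrier)
      have "h (x \<otimes>\<^bsub>KG k\<^esub> y) = (?v u \<otimes> ?v (map (flip s) w)) \<otimes> (?t s \<otimes> ?t r)"
        unfolding xy KG_mult h_def fst_conv snd_conv t_t v_wmult[OF c(1) c(3)] ..
      also have "\<dots> = ?v u \<otimes> ((?v (map (flip s) w) \<otimes> ?t s) \<otimes> ?t r)"
        using v[OF c(1)] v[OF c(2)] v[OF c(3)] t_c[of s] t_c[of r] by (simp only: m_assoc m_closed)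
      also have "\<dots> = h x \<otimes> h y"
        unfolding xy h_def fst_conv snd_conv t_v'[OF c(2), symmetric]
        using v[OF c(1)] v[OF c(2)] v[OF c(3)] t_c[of s] t_c[of r] by (simp only: m_assoc m_closed)
      finally show "h (x \<otimes>\<^bsub>KG k\<^esub> y) = h x \<otimes> h y" .
    qed
    show "h ([], True) = t" using t by (simp add: h_def)
    show "h ([(i, False)], False) = a i" if "i \<in> {1..k}" for i
      using that a by (simp add: h_def letter_val_def)
  qed
qed

end

lemma KG_hom_eq:
  assumes "group H" "f \<in> hom (KG k) H" "g \<in> hom (KG k) H" "f ([], True) = g ([], True)"
    and "\<And>i. i \<in> {1..k} \<Longrightarrow> f ([(i, False)], False) = g ([(i, False)], False)"
    and "x \<in> carrier (KG k)"
  shows "f x = g x"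
proof -
  interpret f: group_hom "KG k" H f
    by (simp add: assms(1,2) group_KG group_hom.intro group_hom_axioms.intro)
  interpret g: group_hom "KG k" H g
    by (simp add: assms(1,3) group_KG group_hom.intro group_hom_axioms.intro)
  have single: "f ([l], False) = g ([l], False)" if l: "fst l \<in> {1..k}" for l
  proof (cases "snd l")
    case False
    then show ?thesis using assms(5)[OF l] by (metis prod.collapse)
  next
    case True
    let ?a = "([(fst l, False)], False)"
    have a: "?a \<in> carrier (KG k)" using l by (auto simp: KG_carrier rwords_Cons)
    have "([l], False) = inv\<^bsub>KG k\<^esub> ?a"
      using a True by (subst KG_inv) (auto simp: KG_carrier winv_def flip_def prod_eq_iff)
    then show ?thesis using assms(5)[OF l] a by simp
  qed
  have word: "f (w, False) = g (w, False)" if "w \<in> rwords k" for w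
    using that
  proof (induction w)
    case Nil
    show ?case using f.hom_one g.hom_one by (simp add: KG_one)
  next
    case (Cons l w)
    have "(l # w, False) = ([l], False) \<otimes>\<^bsub>KG k\<^esub> (w, False)"
      using Cons.prems by (simp add: KG_mult redcons_reduced rwords_Cons)
    moreover have "([l], False) \<in> carrier (KG k)" "(w, False) \<in> carrier (KG k)"
      using Cons.prems by (auto simp: KG_carrier rwords_Cons)
    ultimately show ?case using Cons single[of l] by (simp add: rwords_Cons)
  qed
  obtain w s where x: "x = (w, s)" by (cases x)
  with assms have w: "w \<in> rwords k" by (simp add: KG_carrier)
  have "x = (w, False) \<otimes>\<^bsub>KG k\<^esub> (if s then ([], True) else \<one>\<^bsub>KG k\<^esub>)"
    using w by (auto simp: x KG_mult KG_one wmult_Nil_right)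
  moreover have "(w, False) \<in> carrier (KG k)" "([], True) \<in> carrier (KG k)"
    using w by (auto simp: KG_carrier)
  ultimately show ?thesis using word[OF w] assms(4) by (cases s) auto
qed

section \<open>The presented groups\<close>

lemma Lequiv_refl [simp]: "Lequiv n u u"
  by (simp add: Lequiv_def)

lemma Lequiv_sym: "Lequiv n u v \<Longrightarrow> Lequiv n v u"
  unfolding Lequiv_def by (rule sympD[OF symp_rtranclp]) (auto intro: sympI)

lemma Lequiv_trans: "Lequiv n u v \<Longrightarrow> Lequiv n v w \<Longrightarrow> Lequiv n u w"
  unfolding Lequiv_def by (rule rtranclp_trans)

lemma Lstep_imp_Lequiv: "Lstep n u v \<Longrightarrow> Lequiv n u v"
  unfolding Lequiv_def by (simp add: r_into_rtranclp)

lemma Lstep_append: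
  assumes "Lstep n u v" shows "Lstep n (x @ u @ y) (x @ v @ y)"
proof (rule assms[unfolded Lstep_def, THEN disjE]; elim exE conjE)
  fix a b j assume "1 \<le> j" "j \<le> n - 1" "u = a @ [j, j] @ b" "v = a @ b"
  then show ?thesis
    unfolding Lstep_def by (intro disjI1 exI[of _ "x @ a"] exI[of _ "b @ y"] exI[of _ j]) simp
next
  fix a b i assume "1 \<le> i" "i \<le> n - 2" "u = a @ [i, Suc i, i] @ b" "v = a @ [Suc i, i, Suc i] @ b"
  then show ?thesis
    unfolding Lstep_def by (intro disjI2 exI[of _ "x @ a"] exI[of _ "b @ y"] exI[of _ i]) simp
qed

lemma Lequiv_append:
  assumes "Lequiv n u v" "Lequiv n u' v'" shows "Lequiv n (u @ u') (v @ v')"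
proof -
  have "Lequiv n (x @ u @ y) (x @ v @ y)" if "Lequiv n u v" for u v x y
    using that unfolding Lequiv_def
    by (induction rule: rtranclp_induct) (auto intro: Lstep_append rtranclp.rtrancl_into_rtrancl)
  from this[OF assms(1), of "[]" u'] this[OF assms(2), of v "[]"] show ?thesis
    using Lequiv_trans[of n "u @ u'" "v @ u'" "v @ v'"] by simp
qed

lemma Lclass_eq_iff: "Lclass n u = Lclass n v \<longleftrightarrow> Lequiv n u v"
  unfolding Lclass_def set_eq_iff mem_Collect_eq
  by (meson Lequiv_refl Lequiv_sym Lequiv_trans)

lemma Lgroup_mult: "Lclass n u \<otimes>\<^bsub>Lgroup n\<^esub> Lclass n v = Lclass n (u @ v)"
  unfolding Lgroup_def Lclass_def
  by (auto intro: Lequiv_append Lequiv_trans) (meson Lequiv_refl)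

lemma Lgroup_one: "\<one>\<^bsub>Lgroup n\<^esub> = Lclass n []"
  by (simp add: Lgroup_def)

lemma Lgroup_carrier: "carrier (Lgroup n) = Lclass n ` lists {1..n-1}"
  by (simp add: Lgroup_def)

text \<open>There are no inverse letters in the monoid presentation; since the generators are
  involutions, the reversed word serves as the inverse.\<close>

lemma Lequiv_rev:
  assumes "w \<in> lists {1..n-1}" shows "Lequiv n (rev w @ w) []"
  using assms
proof (induction w)
  case (Cons j w)
  then have "Lstep n (rev w @ [j, j] @ w) (rev w @ w)"
    unfolding Lstep_def by auto
  with Cons show ?case
    by (auto intro: Lequiv_trans Lstep_imp_Lequiv)
qed simp

lemma group_Lgroup: "group (Lgroup n)"
proof (rule groupI)
  fix x assume "x \<in> carrier (Lgroup n)"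
  then obtain w where w: "w \<in> lists {1..n-1}" "x = Lclass n w" by (auto simp: Lgroup_carrier)
  show "\<exists>y\<in>carrier (Lgroup n). y \<otimes>\<^bsub>Lgroup n\<^esub> x = \<one>\<^bsub>Lgroup n\<^esub>"
    using w Lequiv_rev[OF w(1)]
    by (intro bexI[of _ "Lclass n (rev w)"])
       (auto simp: Lgroup_mult Lgroup_one Lclass_eq_iff Lgroup_carrier)
qed (auto simp: Lgroup_mult Lgroup_one Lgroup_carrier intro!: imageI)

text \<open>The equivalence lives on all lists of naturals, whereas an assignment of values is
  controlled only at the generators. Every letter that a relation inserts is itself a generator, so
  a chain of rewritings never leaves the alphabet.\<close>

lemma Lequiv_lists:
  assumes "Lequiv n u v" "u \<in> lists {1..n-1}" shows "v \<in> lists {1..n-1}"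
  using assms unfolding Lequiv_def
  by (induction rule: rtranclp_induct) (auto simp: Lstep_def)

context group
begin

lemma Lgroup_hom_exists:
  assumes y: "\<And>j. j \<in> {1..n-1} \<Longrightarrow> y j \<in> carrier G" "\<And>j. j \<in> {1..n-1} \<Longrightarrow> y j \<otimes> y j = \<one>"
    and braid: "\<And>i. i \<in> {1..n-2} \<Longrightarrow> y i \<otimes> y (Suc i) \<otimes> y i = y (Suc i) \<otimes> y i \<otimes> y (Suc i)"
  obtains h where "h \<in> hom (Lgroup n) G" "\<And>j. j \<in> {1..n-1} \<Longrightarrow> h (Lclass n [j]) = y j"
proof -
  have c: "word_val y w \<in> carrier G" if "w \<in> lists {1..n-1}" for w
    using that y(1) by (intro word_val_closed) auto
  have app: "word_val y (u @ v) = word_val y u \<otimes> word_val y v"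
    if "u \<in> lists {1..n-1}" "v \<in> lists {1..n-1}" for u v
    using that y(1) by (intro word_val_append) auto
  have step: "word_val y u = word_val y v"
    if "Lstep n u v" "u \<in> lists {1..n-1}" for u v
    using that(1) unfolding Lstep_def
  proof (elim disjE exE conjE)
    fix a b j assume *: "1 \<le> j" "j \<le> n - 1" "u = a @ [j, j] @ b" "v = a @ b"
    then have "a \<in> lists {1..n-1}" "b \<in> lists {1..n-1}" "j \<in> {1..n-1}" using that(2) by auto
    then show ?thesis using * y(1)[of j] y(2)[of j] c[of a] c[of b]
      by (simp add: app) (simp flip: m_assoc)
  next
    fix a b i assume *: "1 \<le> i" "i \<le> n - 2" "u = a @ [i, Suc i, i] @ b" "v = a @ [Suc i, i, Suc i] @ b"
    then have ab: "a \<in> lists {1..n-1}" "b \<in> lists {1..n-1}" "i \<in> {1..n-1}" "Suc i \<in> {1..n-1}"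
      using that(2) by auto
    have "word_val y ([i, Suc i, i] @ b) = y i \<otimes> y (Suc i) \<otimes> y i \<otimes> word_val y b"
      "word_val y ([Suc i, i, Suc i] @ b) = y (Suc i) \<otimes> y i \<otimes> y (Suc i) \<otimes> word_val y b"
      using ab y(1)[of i] y(1)[of "Suc i"] c[of b] by (simp_all add: m_assoc)
    with braid[of i] * have "word_val y ([i, Suc i, i] @ b) = word_val y ([Suc i, i, Suc i] @ b)"
      by simp
    with ab show ?thesis unfolding * by (subst (1 2) app) auto
  qed
  note step_eq = step
  have eq: "word_val y u = word_val y v" if "Lequiv n u v" "u \<in> lists {1..n-1}" for u v
    using that(1) unfolding Lequiv_def
  proof (induction rule: rtranclp_induct)
    case (step v w)
    then have "v \<in> lists {1..n-1}" "w \<in> lists {1..n-1}"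
      using Lequiv_lists[OF _ that(2)] unfolding Lequiv_def
      by (blast intro: rtranclp.rtrancl_into_rtrancl)+
    with step show ?case using step_eq by metis
  qed simp
  define h where "h A = word_val y (SOME w. w \<in> A)" for A
  have h: "h (Lclass n u) = word_val y u" if "u \<in> lists {1..n-1}" for u
  proof -
    have "(SOME w. w \<in> Lclass n u) \<in> Lclass n u"
      by (rule someI[of _ u]) (simp add: Lclass_def)
    then show ?thesis unfolding h_def using eq[OF _ that] by (simp add: Lclass_def)
  qed
  show ?thesis
  proof (rule that)
    show "h \<in> hom (Lgroup n) G"
      by (rule homI; unfold Lgroup_carrier; elim imageE; simp add: h c Lgroup_mult app)
    show "h (Lclass n [j]) = y j" if "j \<in> {1..n-1}" for j
      using h[of "[j]"] that y(1)[OF that] by simp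
  qed
qed

end

lemma Lgroup_hom_eq:
  assumes "group H" "f \<in> hom (Lgroup n) H" "g \<in> hom (Lgroup n) H"
    and "\<And>j. j \<in> {1..n-1} \<Longrightarrow> f (Lclass n [j]) = g (Lclass n [j])"
    and "x \<in> carrier (Lgroup n)"
  shows "f x = g x"
proof -
  interpret f: group_hom "Lgroup n" H f
    by (simp add: assms(1,2) group_Lgroup group_hom.intro group_hom_axioms.intro)
  interpret g: group_hom "Lgroup n" H g
    by (simp add: assms(1,3) group_Lgroup group_hom.intro group_hom_axioms.intro)
  have "f (Lclass n w) = g (Lclass n w)" if "w \<in> lists {1..n-1}" for w
    using that
  proof (induction w)
    case Nil
    show ?case using f.hom_one g.hom_one by (simp add: Lgroup_one)
  next
    case (Cons j w)
    have "Lclass n (j # w) = Lclass n [j] \<otimes>\<^bsub>Lgroup n\<^esub> Lclass n w"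
      by (simp add: Lgroup_mult)
    moreover have "Lclass n [j] \<in> carrier (Lgroup n)" "Lclass n w \<in> carrier (Lgroup n)"
      using Cons by (auto simp: Lgroup_carrier)
    ultimately show ?case using Cons assms(4)[of j] by simp
  qed
  then show ?thesis using assms(5) by (auto simp: Lgroup_carrier)
qed

section \<open>Braid relations versus order-three elements inverted by an involution\<close>

lemma (in group) conj_closed_mult:
  assumes "g \<in> carrier G" "x \<in> carrier G" "y \<in> carrier G"
  shows "(g \<otimes> x \<otimes> inv g) \<otimes> (g \<otimes> y \<otimes> inv g) = g \<otimes> (x \<otimes> y) \<otimes> inv g"
proof -
  have "inv g \<otimes> (g \<otimes> (y \<otimes> inv g)) = y \<otimes> inv g"
    using assms by (simp flip: m_assoc)
  then show ?thesis using assms by (simp add: m_assoc)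
qed

text \<open>The elements \<open>a\<close> and \<open>t\<close> generate a quotient of S_3, where
  \<open>t\<close> and \<open>a t a^-1\<close> satisfy the braid relation; conjugation by
  \<open>g\<close> transports this. The second equation rests on \<open>t (a t a^-1) = a\<close>:
  two consecutive generators carry the prefix \<open>g\<close> to the next prefix
  \<open>g \<otimes> a\<close>.\<close>

lemma (in group) dihedral_braid:
  assumes c: "g \<in> carrier G" "a \<in> carrier G" "t \<in> carrier G"
    and t: "t \<otimes> t = \<one>" and a: "a \<otimes> a \<otimes> a = \<one>" and ta: "t \<otimes> a \<otimes> t = inv a"
    and s: "s = g \<otimes> t \<otimes> inv g" and s': "s' = (g \<otimes> a) \<otimes> t \<otimes> inv (g \<otimes> a)"
  shows "s \<otimes> s' \<otimes> s = s' \<otimes> s \<otimes> s'" "s \<otimes> s' \<otimes> g = g \<otimes> a"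
proof -
  have at: "a \<otimes> t = t \<otimes> inv a"
    using c t ta by (metis inv_closed m_assoc m_closed l_one)
  have aa: "a \<otimes> a = inv a"
    using c a by (metis inv_equality m_closed r_inv_ex inv_unique' l_inv)
  have b: "a \<otimes> t \<otimes> inv a = t \<otimes> a"
  proof -
    have "a \<otimes> t \<otimes> inv a = t \<otimes> (inv a \<otimes> inv a)" using c by (simp add: at m_assoc)
    also have "inv a \<otimes> inv a = a" using c aa by (metis inv_inv inv_mult_group inv_closed)
    finally show ?thesis .
  qed
  have s'': "s' = g \<otimes> (t \<otimes> a) \<otimes> inv g"
    using c by (simp add: s' inv_mult_group b[symmetric] m_assoc)
  have ss': "s \<otimes> s' = g \<otimes> a \<otimes> inv g"
    unfolding s s'' using c t by (subst conj_closed_mult) (simp_all flip: m_assoc)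
  have s's: "s' \<otimes> s = g \<otimes> (inv a) \<otimes> inv g"
    unfolding s s'' using c ta by (subst conj_closed_mult) simp_all
  show "s \<otimes> s' \<otimes> g = g \<otimes> a" unfolding ss' using c by (simp add: m_assoc)
  have "s \<otimes> s' \<otimes> s = g \<otimes> (a \<otimes> t) \<otimes> inv g"
    unfolding ss' unfolding s using c by (simp add: conj_closed_mult)
  moreover have "s' \<otimes> s \<otimes> s' = g \<otimes> (inv a \<otimes> (t \<otimes> a)) \<otimes> inv g"
    unfolding s's unfolding s'' using c by (simp add: conj_closed_mult)
  moreover have "inv a \<otimes> (t \<otimes> a) = a \<otimes> t"
    using c b aa by (metis at inv_closed inv_inv inv_mult_group m_assoc m_closed)
  ultimately show "s \<otimes> s' \<otimes> s = s' \<otimes> s \<otimes> s'" by simp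
qed

text \<open>Converse of \<open>dihedral_braid\<close>. A product of two involutions is inverted by
  either of them, and the braid relation makes the cube of \<open>y \<otimes> z\<close> trivial;
  conjugating back by \<open>g\<close> turns the inverting involution \<open>y\<close> into the
  fixed \<open>t\<close>.\<close>

lemma (in group) braid_dihedral:
  assumes c: "y \<in> carrier G" "z \<in> carrier G" "g \<in> carrier G" "t \<in> carrier G"
    and y: "y \<otimes> y = \<one>" and z: "z \<otimes> z = \<one>" and b: "y \<otimes> z \<otimes> y = z \<otimes> y \<otimes> z"
    and t: "t \<otimes> t = \<one>" and yt: "y = g \<otimes> t \<otimes> inv g" and a: "a = inv g \<otimes> (y \<otimes> z \<otimes> g)"
  shows "a \<in> carrier G" "a \<otimes> a \<otimes> a = \<one>" "t \<otimes> a \<otimes> t = inv a"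
    "z = (y \<otimes> z \<otimes> g) \<otimes> t \<otimes> inv (y \<otimes> z \<otimes> g)" "g \<otimes> a = y \<otimes> z \<otimes> g"
proof -
  have inv: "inv y = y" "inv z = z" "inv t = t" using c y z t by (simp_all add: inv_equality)
  have a': "a = inv g \<otimes> (y \<otimes> z) \<otimes> inv (inv g)" using c by (simp add: a m_assoc)
  show ac: "a \<in> carrier G" using c by (simp add: a)
  \<comment> \<open>Regrouping gives \<open>(y z y) (z y z)\<close>, which by the braid relation is
    the square of \<open>y z y\<close>, a conjugate of an involution.\<close>
  have cube: "(y \<otimes> z) \<otimes> (y \<otimes> z) \<otimes> (y \<otimes> z) = \<one>"
  proof -
    have "(y \<otimes> z) \<otimes> (y \<otimes> z) \<otimes> (y \<otimes> z) = (y \<otimes> z \<otimes> y) \<otimes> (z \<otimes> y \<otimes> z)"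
      using c by (simp add: m_assoc)
    also have "\<dots> = (y \<otimes> z \<otimes> y) \<otimes> (y \<otimes> z \<otimes> y)" by (simp only: b)
    also have "\<dots> = y \<otimes> (z \<otimes> ((y \<otimes> y) \<otimes> (z \<otimes> y)))" using c by (simp add: m_assoc)
    also have "\<dots> = y \<otimes> ((z \<otimes> z) \<otimes> y)" using c y by (simp add: m_assoc)
    finally show ?thesis using c y z by simp
  qed
  show "a \<otimes> a \<otimes> a = \<one>"
    unfolding a' using c by (simp only: conj_closed_mult inv_closed m_closed cube) simp
  have tg: "t \<otimes> inv g = inv g \<otimes> y"
    unfolding yt using c by (simp flip: m_assoc)
  have gt: "g \<otimes> t = y \<otimes> g"
    unfolding yt using c by (simp add: m_assoc)
  have "t \<otimes> a \<otimes> t = (t \<otimes> inv g) \<otimes> ((y \<otimes> z) \<otimes> (g \<otimes> t))"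
    using c by (simp add: a m_assoc)
  also have "\<dots> = inv g \<otimes> ((y \<otimes> y) \<otimes> (z \<otimes> (y \<otimes> g)))"
    unfolding tg gt using c by (simp add: m_assoc)
  also have "\<dots> = inv a"
    using c y by (simp add: a inv_mult_group inv m_assoc)
  finally show "t \<otimes> a \<otimes> t = inv a" .
  show "g \<otimes> a = y \<otimes> z \<otimes> g" unfolding a using c by (simp flip: m_assoc)
  have "(y \<otimes> z \<otimes> g) \<otimes> t \<otimes> inv (y \<otimes> z \<otimes> g) = (y \<otimes> z) \<otimes> (g \<otimes> t \<otimes> inv g) \<otimes> (z \<otimes> y)"
    using c by (simp add: inv_mult_group inv m_assoc)
  also have "\<dots> = (y \<otimes> z \<otimes> y) \<otimes> (z \<otimes> y)"
    unfolding yt[symmetric] using c by (simp add: m_assoc)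
  also have "\<dots> = z \<otimes> (y \<otimes> ((z \<otimes> z) \<otimes> y))" unfolding b using c by (simp add: m_assoc)
  finally show "z = (y \<otimes> z \<otimes> g) \<otimes> t \<otimes> inv (y \<otimes> z \<otimes> g)" using c y z by simp
qed

abbreviation kt :: "letter list \<times> bool" where "kt \<equiv> ([], True)"
abbreviation ka :: "nat \<Rightarrow> letter list \<times> bool" where "ka i \<equiv> ([(i, False)], False)"

lemma kt_closed [simp]: "kt \<in> carrier (KG k)"
  by (simp add: KG_carrier)

lemma ka_closed [simp]: "i \<in> {1..k} \<Longrightarrow> ka i \<in> carrier (KG k)"
  by (simp add: KG_carrier rwords_Cons)

lemma ka_relations:
  assumes "i \<in> {1..k}"
  shows "ka i \<otimes>\<^bsub>KG k\<^esub> ka i \<otimes>\<^bsub>KG k\<^esub> ka i = \<one>\<^bsub>KG k\<^esub>"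
    "kt \<otimes>\<^bsub>KG k\<^esub> ka i \<otimes>\<^bsub>KG k\<^esub> kt = inv\<^bsub>KG k\<^esub> ka i"
  using assms KG_inv[of "[(i, False)]" k False]
  by (simp_all add: KG_mult KG_one winv_def rwords_Cons flip_def)

lemma kt_kt: "kt \<otimes>\<^bsub>KG k\<^esub> kt = \<one>\<^bsub>KG k\<^esub>"
  by (simp add: KG_mult KG_one)

lemma Lgroup_relations:
  "j \<in> {1..n-1} \<Longrightarrow> Lclass n [j] \<in> carrier (Lgroup n)"
  "j \<in> {1..n-1} \<Longrightarrow> Lclass n [j] \<otimes>\<^bsub>Lgroup n\<^esub> Lclass n [j] = \<one>\<^bsub>Lgroup n\<^esub>"
  "i \<in> {1..n-2} \<Longrightarrow> Lclass n [i] \<otimes>\<^bsub>Lgroup n\<^esub> Lclass n [Suc i] \<otimes>\<^bsub>Lgroup n\<^esub> Lclass n [i] =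
     Lclass n [Suc i] \<otimes>\<^bsub>Lgroup n\<^esub> Lclass n [i] \<otimes>\<^bsub>Lgroup n\<^esub> Lclass n [Suc i]"
proof -
  show "Lclass n [j] \<in> carrier (Lgroup n)" if "j \<in> {1..n-1}"
    using that by (auto simp: Lgroup_carrier)
  show "Lclass n [j] \<otimes>\<^bsub>Lgroup n\<^esub> Lclass n [j] = \<one>\<^bsub>Lgroup n\<^esub>" if "j \<in> {1..n-1}"
  proof -
    have "Lstep n ([] @ [j, j] @ []) ([] @ [])" using that unfolding Lstep_def by fastforce
    then show ?thesis by (auto simp: Lgroup_mult Lgroup_one Lclass_eq_iff dest: Lstep_imp_Lequiv)
  qed
  show "Lclass n [i] \<otimes>\<^bsub>Lgroup n\<^esub> Lclass n [Suc i] \<otimes>\<^bsub>Lgroup n\<^esub> Lclass n [i] =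
     Lclass n [Suc i] \<otimes>\<^bsub>Lgroup n\<^esub> Lclass n [i] \<otimes>\<^bsub>Lgroup n\<^esub> Lclass n [Suc i]" if "i \<in> {1..n-2}"
  proof -
    have "Lstep n ([] @ [i, Suc i, i] @ []) ([] @ [Suc i, i, Suc i] @ [])"
      using that unfolding Lstep_def atLeastAtMost_iff by blast
    then show ?thesis by (auto simp: Lgroup_mult Lclass_eq_iff dest: Lstep_imp_Lequiv)
  qed
qed

lemma Lgroup_iso_KG:
  assumes "2 \<le> n" shows "Lgroup n \<cong> KG (n - 2)"
proof -
  let ?k = "n - 2"
  interpret K: group "KG ?k" by (rule group_KG)
  interpret L: group "Lgroup n" by (rule group_Lgroup)
  \<comment> \<open>\<open>G i\<close> is the prefix \<open>a_1 ... a_i\<close>.\<close>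
  define G where "G = rec_nat \<one>\<^bsub>KG ?k\<^esub> (\<lambda>i x. x \<otimes>\<^bsub>KG ?k\<^esub> ka (Suc i))"
  have G0: "G 0 = \<one>\<^bsub>KG ?k\<^esub>" and GS: "G (Suc i) = G i \<otimes>\<^bsub>KG ?k\<^esub> ka (Suc i)" for i
    by (simp_all add: G_def)
  have Gc: "G i \<in> carrier (KG ?k)" if "i \<le> ?k" for i
    using that by (induction i) (simp_all add: G0 GS)
  \<comment> \<open>The shift makes \<open>Y 1\<close> equal to \<open>kt\<close>, which has the
    empty prefix.\<close>
  define Y where "Y j = G (j - 1) \<otimes>\<^bsub>KG ?k\<^esub> kt \<otimes>\<^bsub>KG ?k\<^esub> inv\<^bsub>KG ?k\<^esub> G (j - 1)" for j
  have Yc: "Y j \<in> carrier (KG ?k)" if "j \<in> {1..n-1}" for j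
  proof -
    have "j - 1 \<le> ?k" using that by auto
    from Gc[OF this] show ?thesis by (simp add: Y_def)
  qed
  have Y_rel: "Y (Suc i) \<otimes>\<^bsub>KG ?k\<^esub> Y (Suc (Suc i)) \<otimes>\<^bsub>KG ?k\<^esub> Y (Suc i) =
      Y (Suc (Suc i)) \<otimes>\<^bsub>KG ?k\<^esub> Y (Suc i) \<otimes>\<^bsub>KG ?k\<^esub> Y (Suc (Suc i))"
    "Y (Suc i) \<otimes>\<^bsub>KG ?k\<^esub> Y (Suc (Suc i)) \<otimes>\<^bsub>KG ?k\<^esub> G i = G (Suc i)" if "i < ?k" for i
    using K.dihedral_braid[OF Gc[of i] ka_closed[of "Suc i"] kt_closed kt_kt
        ka_relations[of "Suc i"], of "Y (Suc i)" "Y (Suc (Suc i))"] that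
    by (simp_all add: Y_def GS)
  have Y_sq: "Y j \<otimes>\<^bsub>KG ?k\<^esub> Y j = \<one>\<^bsub>KG ?k\<^esub>" if "j \<in> {1..n-1}" for j
  proof -
    have "j - 1 \<le> ?k" using that by auto
    from Gc[OF this] show ?thesis by (simp add: Y_def K.conj_closed_mult kt_kt)
  qed
  obtain f where f: "f \<in> hom (Lgroup n) (KG ?k)" and fY: "\<And>j. j \<in> {1..n-1} \<Longrightarrow> f (Lclass n [j]) = Y j"
  proof (rule K.Lgroup_hom_exists[of n Y])
    show "Y i \<otimes>\<^bsub>KG ?k\<^esub> Y (Suc i) \<otimes>\<^bsub>KG ?k\<^esub> Y i = Y (Suc i) \<otimes>\<^bsub>KG ?k\<^esub> Y i \<otimes>\<^bsub>KG ?k\<^esub> Y (Suc i)"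
      if "i \<in> {1..n-2}" for i
      using Y_rel(1)[of "i - 1"] that by (cases i) auto
  qed (use Yc Y_sq in auto)
  interpret f: group_hom "Lgroup n" "KG ?k" f
    by (simp add: f group_hom.intro group_hom_axioms.intro)

  let ?y = "\<lambda>j. Lclass n [j]"
  \<comment> \<open>In the presented group the order-three elements are not yet available, so the
    prefixes come first. The recursion copies the second conclusion of
    \<open>dihedral_braid\<close>, in which the next prefix is obtained by multiplying with two
    consecutive generators from the left.\<close>
  define g where "g = rec_nat \<one>\<^bsub>Lgroup n\<^esub> (\<lambda>i x. ?y (Suc i) \<otimes>\<^bsub>Lgroup n\<^esub> ?y (Suc (Suc i)) \<otimes>\<^bsub>Lgroup n\<^esub> x)"
  have g0: "g 0 = \<one>\<^bsub>Lgroup n\<^esub>"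
    and gS: "g (Suc i) = ?y (Suc i) \<otimes>\<^bsub>Lgroup n\<^esub> ?y (Suc (Suc i)) \<otimes>\<^bsub>Lgroup n\<^esub> g i" for i
    by (simp_all add: g_def)
  have gc: "g i \<in> carrier (Lgroup n)" if "i \<le> ?k" for i
    using that by (induction i) (simp_all add: g0 gS Lgroup_relations)
  \<comment> \<open>The ratio of consecutive prefixes is the only choice for which a homomorphism
    can send each \<open>G i\<close> to \<open>g i\<close>.\<close>
  define \<alpha> where "\<alpha> i = inv\<^bsub>Lgroup n\<^esub> g (i - 1) \<otimes>\<^bsub>Lgroup n\<^esub> g i" for i
  have one: "1 \<in> {1..n-1}" using assms by auto
  have key: "?y (Suc i) = g i \<otimes>\<^bsub>Lgroup n\<^esub> ?y 1 \<otimes>\<^bsub>Lgroup n\<^esub> inv\<^bsub>Lgroup n\<^esub> g i" if "i \<le> ?k" for i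
    using that
  proof (induction i)
    case 0
    show ?case using Lgroup_relations(1)[OF one] by (simp add: g0)
  next
    case (Suc i)
    then have "Suc i \<in> {1..n-1}" "Suc (Suc i) \<in> {1..n-1}" "Suc i \<in> {1..n-2}" "i \<le> ?k" by auto
    from L.braid_dihedral(4)[OF Lgroup_relations(1)[OF this(1)] Lgroup_relations(1)[OF this(2)]
        gc[OF this(4)] Lgroup_relations(1)[OF one] Lgroup_relations(2)[OF this(1)]
        Lgroup_relations(2)[OF this(2)] Lgroup_relations(3)[OF this(3)] Lgroup_relations(2)[OF one] _ refl]
    show ?case using Suc by (simp add: gS)
  qed
  have \<alpha>: "\<alpha> i \<in> carrier (Lgroup n)"
    "\<alpha> i \<otimes>\<^bsub>Lgroup n\<^esub> \<alpha> i \<otimes>\<^bsub>Lgroup n\<^esub> \<alpha> i = \<one>\<^bsub>Lgroup n\<^esub>"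
    "?y 1 \<otimes>\<^bsub>Lgroup n\<^esub> \<alpha> i \<otimes>\<^bsub>Lgroup n\<^esub> ?y 1 = inv\<^bsub>Lgroup n\<^esub> \<alpha> i"
    "g (i - 1) \<otimes>\<^bsub>Lgroup n\<^esub> \<alpha> i = g i" if "i \<in> {1..?k}" for i
  proof -
    obtain j where j: "i = Suc j" "j < ?k" using \<open>i \<in> {1..?k}\<close> by (cases i) auto
    then have "Suc j \<in> {1..n-1}" "Suc (Suc j) \<in> {1..n-1}" "Suc j \<in> {1..n-2}" "j \<le> ?k" by auto
    note * = L.braid_dihedral[OF Lgroup_relations(1)[OF this(1)] Lgroup_relations(1)[OF this(2)]
        gc[OF this(4)] Lgroup_relations(1)[OF one] Lgroup_relations(2)[OF this(1)]
        Lgroup_relations(2)[OF this(2)] Lgroup_relations(3)[OF this(3)] Lgroup_relations(2)[OF one]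
        key[OF this(4)], of "\<alpha> i"]
    have \<alpha>_eq: "\<alpha> i = inv\<^bsub>Lgroup n\<^esub> g j \<otimes>\<^bsub>Lgroup n\<^esub> (?y (Suc j) \<otimes>\<^bsub>Lgroup n\<^esub> ?y (Suc (Suc j)) \<otimes>\<^bsub>Lgroup n\<^esub> g j)"
      using gS[of j] by (simp add: \<alpha>_def j)
    show "\<alpha> i \<in> carrier (Lgroup n)"
      "\<alpha> i \<otimes>\<^bsub>Lgroup n\<^esub> \<alpha> i \<otimes>\<^bsub>Lgroup n\<^esub> \<alpha> i = \<one>\<^bsub>Lgroup n\<^esub>"
      "?y 1 \<otimes>\<^bsub>Lgroup n\<^esub> \<alpha> i \<otimes>\<^bsub>Lgroup n\<^esub> ?y 1 = inv\<^bsub>Lgroup n\<^esub> \<alpha> i"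
      using *(1-3)[OF \<alpha>_eq] by auto
    show "g (i - 1) \<otimes>\<^bsub>Lgroup n\<^esub> \<alpha> i = g i" using *(5)[OF \<alpha>_eq] j gS[of j] by simp
  qed
  obtain h where h: "h \<in> hom (KG ?k) (Lgroup n)" and ht: "h kt = ?y 1"
    and ha: "\<And>i. i \<in> {1..?k} \<Longrightarrow> h (ka i) = \<alpha> i"
    using L.KG_hom_exists[of ?k \<alpha> "?y 1", OF \<alpha>(1,2) Lgroup_relations(1)[OF one] Lgroup_relations(2)[OF one] \<alpha>(3)]
    by metis
  interpret h: group_hom "KG ?k" "Lgroup n" h
    by (simp add: h group_hom.intro group_hom_axioms.intro)

  \<comment> \<open>The two families of prefixes correspond under both maps; this reduces both
    compositions to a comparison on generators.\<close>
  have hG: "h (G i) = g i" if "i \<le> ?k" for i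
    using that
  proof (induction i)
    case 0
    show ?case using h.hom_one by (simp add: G0 g0)
  next
    case (Suc i)
    then show ?case using \<alpha>(4)[of "Suc i"] ha[of "Suc i"] Gc[of i] by (simp add: GS)
  qed
  have fg: "f (g i) = G i" if "i \<le> ?k" for i
    using that
  proof (induction i)
    case 0
    show ?case using f.hom_one by (simp add: G0 g0)
  next
    case (Suc i)
    then have "f (g (Suc i)) = Y (Suc i) \<otimes>\<^bsub>KG ?k\<^esub> Y (Suc (Suc i)) \<otimes>\<^bsub>KG ?k\<^esub> G i"
      using gc[of i] Lgroup_relations(1)[of "Suc i" n] Lgroup_relations(1)[of "Suc (Suc i)" n]
      by (simp add: gS fY)
    then show ?case using Y_rel(2)[of i] Suc by simp
  qed
  have hf: "h (f x) = x" if "x \<in> carrier (Lgroup n)" for x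
  proof -
    have "(h \<circ> f) x = id x"
    proof (rule Lgroup_hom_eq[OF group_Lgroup _ _ _ that])
      show "h \<circ> f \<in> hom (Lgroup n) (Lgroup n)" using f h by (rule hom_compose)
      show "id \<in> hom (Lgroup n) (Lgroup n)" by (simp add: hom_def)
      show "(h \<circ> f) (?y j) = id (?y j)" if "j \<in> {1..n-1}" for j
      proof -
        have j: "j - 1 \<le> ?k" "Suc (j - 1) = j" using that by auto
        have "h (Y j) = g (j - 1) \<otimes>\<^bsub>Lgroup n\<^esub> ?y 1 \<otimes>\<^bsub>Lgroup n\<^esub> inv\<^bsub>Lgroup n\<^esub> g (j - 1)"
          using Gc[OF j(1)] hG[OF j(1)] ht by (simp add: Y_def)
        also have "\<dots> = ?y j" unfolding key[OF j(1), symmetric] j(2) ..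
        finally have "h (Y j) = ?y j" .
        then show ?thesis using fY[OF that] by simp
      qed
    qed
    then show ?thesis by simp
  qed
  have fh: "f (h x) = x" if "x \<in> carrier (KG ?k)" for x
  proof -
    have "(f \<circ> h) x = id x"
    proof (rule KG_hom_eq[OF group_KG _ _ _ _ that])
      show "f \<circ> h \<in> hom (KG ?k) (KG ?k)" using h f by (rule hom_compose)
      show "id \<in> hom (KG ?k) (KG ?k)" by (simp add: hom_def)
      show "(f \<circ> h) kt = id kt" using fY[OF one] by (simp add: ht Y_def G0)
      show "(f \<circ> h) (ka i) = id (ka i)" if i: "i \<in> {1..?k}" for i
      proof -
        have *: "i - 1 \<le> ?k" "i \<le> ?k" using i by auto
        have Gi: "G i = G (i - 1) \<otimes>\<^bsub>KG ?k\<^esub> ka i"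
          using GS[of "i - 1"] i by simp
        have "f (\<alpha> i) = inv\<^bsub>KG ?k\<^esub> G (i - 1) \<otimes>\<^bsub>KG ?k\<^esub> G i"
          using gc[OF *(1)] gc[OF *(2)] fg[OF *(1)] fg[OF *(2)] by (simp add: \<alpha>_def)
        also have "\<dots> = ka i"
          unfolding Gi using Gc[OF *(1)] ka_closed[OF i] by (simp flip: K.m_assoc)
        finally show ?thesis using ha[OF i] by simp
      qed
    qed
    then show ?thesis by simp
  qed
  have "f \<in> iso (Lgroup n) (KG ?k)"
    unfolding iso_def using f
    by (auto intro!: bij_betw_byWitness[where f' = h] simp: hf fh)
  then show ?thesis by (rule is_isoI)
qed

section \<open>Semidirect products and automorphism groups\<close>

text \<open>The action is conjugation in \<open>G\<close>, pulled back along the embedding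
  \<open>j\<close>. Only an embedding is claimed, because the lower layer of the tower may be a
  proper subgroup; the lemma serves both layers and also the quotient.\<close>

lemma semidirect_product_hom:
  assumes G: "group G" and X: "group X" and Y: "group Y"
    and j: "j \<in> hom X G" "inj_on j (carrier X)" and s: "s \<in> hom Y G" "inj_on s (carrier Y)"
    and norm: "\<And>x y. x \<in> carrier X \<Longrightarrow> y \<in> carrier Y \<Longrightarrow>
      s y \<otimes>\<^bsub>G\<^esub> j x \<otimes>\<^bsub>G\<^esub> inv\<^bsub>G\<^esub> s y \<in> j ` carrier X"
    and triv: "\<And>x y. x \<in> carrier X \<Longrightarrow> y \<in> carrier Y \<Longrightarrow> j x = s y \<Longrightarrow> y = \<one>\<^bsub>Y\<^esub>"
  obtains \<phi> where "\<phi> \<in> hom Y (AutoGroup X)" "group (semidirect_product X Y \<phi>)"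
    "(\<lambda>p. j (fst p) \<otimes>\<^bsub>G\<^esub> s (snd p)) \<in> hom (semidirect_product X Y \<phi>) G"
    "inj_on (\<lambda>p. j (fst p) \<otimes>\<^bsub>G\<^esub> s (snd p)) (carrier (semidirect_product X Y \<phi>))"
proof -
  interpret G: group G by fact
  interpret X: group X by fact
  interpret Y: group Y by fact
  interpret j: group_hom X G j by (simp add: j group_hom.intro group_hom_axioms.intro G X)
  interpret s: group_hom Y G s by (simp add: s group_hom.intro group_hom_axioms.intro G Y)
  define c where "c y x = inv_into (carrier X) j (s y \<otimes>\<^bsub>G\<^esub> j x \<otimes>\<^bsub>G\<^esub> inv\<^bsub>G\<^esub> s y)" for y x
  have c: "c y x \<in> carrier X" "j (c y x) = s y \<otimes>\<^bsub>G\<^esub> j x \<otimes>\<^bsub>G\<^esub> inv\<^bsub>G\<^esub> s y"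
    if "x \<in> carrier X" "y \<in> carrier Y" for x y
    using norm[OF that] by (auto simp: c_def inv_into_into f_inv_into_f)
  have jI: "x = x'" if "x \<in> carrier X" "x' \<in> carrier X" "j x = j x'" for x x'
    using j(2) that by (auto dest: inj_onD)
  have c_hom: "c y (x \<otimes>\<^bsub>X\<^esub> x') = c y x \<otimes>\<^bsub>X\<^esub> c y x'"
    if "x \<in> carrier X" "x' \<in> carrier X" "y \<in> carrier Y" for x x' y
  proof (rule jI)
    have "inv\<^bsub>G\<^esub> s y \<otimes>\<^bsub>G\<^esub> (s y \<otimes>\<^bsub>G\<^esub> (j x' \<otimes>\<^bsub>G\<^esub> inv\<^bsub>G\<^esub> s y)) = j x' \<otimes>\<^bsub>G\<^esub> inv\<^bsub>G\<^esub> s y"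
      using that by (simp flip: G.m_assoc del: s.hom_inv)
    then show "j (c y (x \<otimes>\<^bsub>X\<^esub> x')) = j (c y x \<otimes>\<^bsub>X\<^esub> c y x')"
      using that c by (simp add: G.m_assoc del: s.hom_inv)
  qed (use that c in auto)
  have c_comp: "c (y \<otimes>\<^bsub>Y\<^esub> y') x = c y (c y' x)"
    if "x \<in> carrier X" "y \<in> carrier Y" "y' \<in> carrier Y" for x y y'
    by (rule jI) (use that c in \<open>auto simp: G.inv_mult_group G.m_assoc simp del: s.hom_inv\<close>)
  have c_one: "c \<one>\<^bsub>Y\<^esub> x = x" if "x \<in> carrier X" for x
    by (rule jI) (use that c in auto)
  have c_inv: "c (inv\<^bsub>Y\<^esub> y) (c y x) = x" "c y (c (inv\<^bsub>Y\<^esub> y) x) = x"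
    if "x \<in> carrier X" "y \<in> carrier Y" for x y
    using that c_comp[of x "inv\<^bsub>Y\<^esub> y" y] c_comp[of x y "inv\<^bsub>Y\<^esub> y"] by (auto simp: c_one)
  \<comment> \<open>Elements of \<open>AutoGroup X\<close> are extensional functions, hence the
    restriction.\<close>
  define \<phi> where "\<phi> y = restrict (c y) (carrier X)" for y
  have \<phi>_Bij: "\<phi> y \<in> Bij (carrier X)" if "y \<in> carrier Y" for y
  proof -
    have "bij_betw (c y) (carrier X) (carrier X)"
      by (rule bij_betw_byWitness[where f' = "c (inv\<^bsub>Y\<^esub> y)"]) (use that c c_inv in auto)
    then show ?thesis by (auto simp: \<phi>_def Bij_def)
  qed
  have \<phi>: "\<phi> y \<in> auto X" if "y \<in> carrier Y" for y
    using that \<phi>_Bij[OF that] c c_hom by (auto simp: auto_def \<phi>_def hom_def)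
  have \<phi>_hom: "\<phi> \<in> hom Y (AutoGroup X)"
  proof (rule homI)
    fix y y' assume y: "y \<in> carrier Y" "y' \<in> carrier Y"
    then show "\<phi> (y \<otimes>\<^bsub>Y\<^esub> y') = \<phi> y \<otimes>\<^bsub>AutoGroup X\<^esub> \<phi> y'"
      using \<phi>_Bij c by (auto simp: AutoGroup_def BijGroup_def \<phi>_def compose_def c_comp)
  qed (use \<phi> in \<open>auto simp: AutoGroup_def\<close>)
  let ?P = "semidirect_product X Y \<phi>"
  let ?f = "\<lambda>p. j (fst p) \<otimes>\<^bsub>G\<^esub> s (snd p)"
  have P: "carrier ?P = carrier X \<times> carrier Y" "\<one>\<^bsub>?P\<^esub> = (\<one>\<^bsub>X\<^esub>, \<one>\<^bsub>Y\<^esub>)"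
    "(x, y) \<otimes>\<^bsub>?P\<^esub> (x', y') = (x \<otimes>\<^bsub>X\<^esub> \<phi> y x', y \<otimes>\<^bsub>Y\<^esub> y')" for x y x' y'
    by (simp_all add: semidirect_product_def)
  have grp: "group ?P"
  proof (rule groupI)
    fix p assume "p \<in> carrier ?P"
    then obtain x y where p: "p = (x, y)" "x \<in> carrier X" "y \<in> carrier Y" by (auto simp: P)
    then show "\<exists>q\<in>carrier ?P. q \<otimes>\<^bsub>?P\<^esub> p = \<one>\<^bsub>?P\<^esub>"
      by (intro bexI[of _ "(inv\<^bsub>X\<^esub> c (inv\<^bsub>Y\<^esub> y) x, inv\<^bsub>Y\<^esub> y)"]) (auto simp: P \<phi>_def c)
  qed (auto simp: P \<phi>_def c c_hom c_comp c_one X.m_assoc Y.m_assoc)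
  have f_hom: "?f \<in> hom ?P G"
  proof (rule homI)
    fix p q assume "p \<in> carrier ?P" "q \<in> carrier ?P"
    then obtain x y x' y' where *: "p = (x, y)" "x \<in> carrier X" "y \<in> carrier Y"
      "q = (x', y')" "x' \<in> carrier X" "y' \<in> carrier Y" by (auto simp: P)
    have "inv\<^bsub>G\<^esub> s y \<otimes>\<^bsub>G\<^esub> (s y \<otimes>\<^bsub>G\<^esub> s y') = s y'"
      using * by (simp flip: G.m_assoc del: s.hom_inv)
    then show "?f (p \<otimes>\<^bsub>?P\<^esub> q) = ?f p \<otimes>\<^bsub>G\<^esub> ?f q"
      using * c by (simp add: P \<phi>_def G.m_assoc del: s.hom_inv)
  qed (auto simp: P)
  interpret f: group_hom ?P G ?f by (simp add: f_hom group_hom.intro group_hom_axioms.intro G grp)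
  have "inj_on ?f (carrier ?P)"
    unfolding f.inj_on_one_iff
  proof (intro allI impI)
    fix p assume "p \<in> carrier ?P" and e: "?f p = \<one>\<^bsub>G\<^esub>"
    then obtain x y where p: "p = (x, y)" "x \<in> carrier X" "y \<in> carrier Y" by (auto simp: P)
    have "j x = s (inv\<^bsub>Y\<^esub> y)" using p e by (simp add: G.inv_equality)
    then have "inv\<^bsub>Y\<^esub> y = \<one>\<^bsub>Y\<^esub>" using p triv by blast
    then have y: "y = \<one>\<^bsub>Y\<^esub>" using p by (metis Y.inv_inv Y.inv_one)
    with e p have "j x = j \<one>\<^bsub>X\<^esub>" by simp
    then show "p = \<one>\<^bsub>?P\<^esub>" using p y jI by (auto simp: P)
  qed
  with that \<phi>_hom grp f_hom show ?thesis by blast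
qed

section \<open>Automorphism groups, inner automorphisms, and transport along isomorphisms\<close>

lemma AutoGroup_carrier: "carrier (AutoGroup G) = auto G"
  by (simp add: AutoGroup_def)

lemma AutoGroup_mult:
  "f \<in> auto G \<Longrightarrow> g \<in> auto G \<Longrightarrow> f \<otimes>\<^bsub>AutoGroup G\<^esub> g = compose (carrier G) f g"
  by (simp add: AutoGroup_def BijGroup_def auto_def)

lemma AutoGroup_one: "\<one>\<^bsub>AutoGroup G\<^esub> = (\<lambda>x\<in>carrier G. x)"
  by (simp add: AutoGroup_def BijGroup_def)

lemma autoI:
  assumes "f \<in> hom G G" "bij_betw f (carrier G) (carrier G)" "f \<in> extensional (carrier G)"
  shows "f \<in> auto G"
  using assms by (simp add: auto_def Bij_def)

lemma autoD:
  assumes "f \<in> auto G"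
  shows "f \<in> hom G G" "bij_betw f (carrier G) (carrier G)" "f \<in> extensional (carrier G)"
  using assms by (auto simp: auto_def Bij_def)

lemma auto_closed: "f \<in> auto G \<Longrightarrow> x \<in> carrier G \<Longrightarrow> f x \<in> carrier G"
  using autoD(1) hom_in_carrier by metis

lemma auto_inj: "f \<in> auto G \<Longrightarrow> f x = f y \<Longrightarrow> x \<in> carrier G \<Longrightarrow> y \<in> carrier G \<Longrightarrow> x = y"
  using autoD(2) by (metis bij_betw_def inj_onD)

definition inner :: "('a, 'b) monoid_scheme \<Rightarrow> 'a \<Rightarrow> 'a \<Rightarrow> 'a" where
  "inner G g = (\<lambda>x\<in>carrier G. g \<otimes>\<^bsub>G\<^esub> x \<otimes>\<^bsub>G\<^esub> inv\<^bsub>G\<^esub> g)"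

lemma Inn_eq: "Inn G = inner G ` carrier G"
  by (auto simp: Inn_def inner_def)

context group
begin

lemma inner_mult:
  assumes "g \<in> carrier G" "h \<in> carrier G"
  shows "inner G (g \<otimes> h) = compose (carrier G) (inner G g) (inner G h)"
  using assms by (auto simp: inner_def compose_def inv_mult_group m_assoc)

lemma inner_one: "inner G \<one> = (\<lambda>x\<in>carrier G. x)"
  by (auto simp: inner_def)

lemma inner_auto:
  assumes g: "g \<in> carrier G" shows "inner G g \<in> auto G"
proof (rule autoI)
  have "inv g \<otimes> (g \<otimes> x) = x" if "x \<in> carrier G" for x
    using that g by (simp flip: m_assoc)
  then show "inner G g \<in> hom G G"
    using g by (auto simp: inner_def hom_def m_assoc)
  have *: "inner G h (inner G (inv h) x) = x" if "h \<in> carrier G" "x \<in> carrier G" for h x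
    using inner_mult[of h "inv h"] that by (auto simp: inner_one compose_def dest: fun_cong[of _ _ x])
  show "bij_betw (inner G g) (carrier G) (carrier G)"
    using *[OF g] *[of "inv g"] g
    by (intro bij_betw_byWitness[where f' = "inner G (inv g)"]) (auto simp: inner_def)
qed (auto simp: inner_def)

lemma inner_hom: "inner G \<in> hom G (AutoGroup G)"
  by (rule homI) (auto simp: AutoGroup_carrier inner_auto AutoGroup_mult inner_mult)

lemma auto_inner:
  assumes f: "f \<in> auto G" and g: "g \<in> carrier G"
  shows "f \<otimes>\<^bsub>AutoGroup G\<^esub> inner G g = inner G (f g) \<otimes>\<^bsub>AutoGroup G\<^esub> f"
proof -
  interpret f: group_hom G G f
    by (simp add: autoD(1)[OF f] group_hom.intro group_hom_axioms.intro is_group)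
  show ?thesis using f g
    by (auto simp: AutoGroup_mult inner_auto auto_closed) (auto simp: inner_def compose_def)
qed

lemma Inn_normal: "Inn G \<lhd> AutoGroup G"
proof -
  interpret A: group "AutoGroup G" by (rule AutoGroup)
  interpret i: group_hom G "AutoGroup G" "inner G"
    by (simp add: inner_hom group_hom.intro group_hom_axioms.intro is_group A.is_group)
  show ?thesis unfolding A.normal_inv_iff
  proof (intro conjI ballI)
    show "subgroup (Inn G) (AutoGroup G)" unfolding Inn_eq by (rule i.img_is_subgroup)
    fix f h assume f: "f \<in> carrier (AutoGroup G)" and "h \<in> Inn G"
    then obtain g where g: "g \<in> carrier G" "h = inner G g" by (auto simp: Inn_eq)
    have fa: "f \<in> auto G" using f by (simp add: AutoGroup_carrier)
    have "f \<otimes>\<^bsub>AutoGroup G\<^esub> h \<otimes>\<^bsub>AutoGroup G\<^esub> inv\<^bsub>AutoGroup G\<^esub> f = inner G (f g)"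
      unfolding g(2) auto_inner[OF fa g(1)] using f auto_closed[OF fa g(1)] by (simp add: A.m_assoc)
    then show "f \<otimes>\<^bsub>AutoGroup G\<^esub> h \<otimes>\<^bsub>AutoGroup G\<^esub> inv\<^bsub>AutoGroup G\<^esub> f \<in> Inn G"
      using auto_closed[OF fa g(1)] by (auto simp: Inn_eq)
  qed
qed

text \<open>Transport is conjugation by \<open>\<theta>\<close>. The formula on inner automorphisms
  is recorded because it carries \<open>Inn G\<close> onto \<open>Inn H\<close>, as needed for the
  outer automorphism groups.\<close>

lemma AutoGroup_iso:
  assumes "group H" "\<theta> \<in> iso G H"
  obtains \<Theta> where "\<Theta> \<in> iso (AutoGroup G) (AutoGroup H)"
    "\<And>g. g \<in> carrier G \<Longrightarrow> \<Theta> (inner G g) = inner H (\<theta> g)"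
proof -
  interpret H: group H by fact
  interpret \<theta>: group_hom G H \<theta>
    using assms(2) by (simp add: iso_def group_hom.intro group_hom_axioms.intro is_group H.is_group)
  have bij: "bij_betw \<theta> (carrier G) (carrier H)" using assms(2) by (simp add: iso_def)
  define \<eta> where "\<eta> = inv_into (carrier G) \<theta>"
  have \<eta>: "\<eta> \<in> iso H G" unfolding \<eta>_def using assms(2) by (rule iso_set_sym)
  interpret \<eta>: group_hom H G \<eta>
    using \<eta> by (simp add: iso_def group_hom.intro group_hom_axioms.intro is_group H.is_group)
  have [simp]: "\<theta> (\<eta> y) = y" if "y \<in> carrier H" for y
    using that bij by (simp add: \<eta>_def bij_betw_inv_into_right)
  have [simp]: "\<eta> (\<theta> x) = x" if "x \<in> carrier G" for x
    using that bij by (simp add: \<eta>_def bij_betw_inv_into_left)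
  define \<Theta> where "\<Theta> f = (\<lambda>y\<in>carrier H. \<theta> (f (\<eta> y)))" for f
  define \<Psi> where "\<Psi> f = (\<lambda>x\<in>carrier G. \<eta> (f (\<theta> x)))" for f
  have \<Theta>: "\<Theta> f \<in> auto H" if f: "f \<in> auto G" for f
  proof (rule autoI)
    show "\<Theta> f \<in> hom H H"
      using autoD(1)[OF f] auto_closed[OF f] by (auto simp: \<Theta>_def hom_def)
    have "bij_betw (\<theta> \<circ> f \<circ> \<eta>) (carrier H) (carrier H)"
      using bij autoD(2)[OF f] \<eta> by (auto simp: iso_def intro!: bij_betw_trans)
    then show "bij_betw (\<Theta> f) (carrier H) (carrier H)"
      by (rule bij_betw_cong[THEN iffD1, rotated]) (simp add: \<Theta>_def)
  qed (simp add: \<Theta>_def)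
  have \<Psi>: "\<Psi> f \<in> auto G" if f: "f \<in> auto H" for f
  proof (rule autoI)
    show "\<Psi> f \<in> hom G G"
      using autoD(1)[OF f] auto_closed[OF f] by (auto simp: \<Psi>_def hom_def)
    have "bij_betw (\<eta> \<circ> f \<circ> \<theta>) (carrier G) (carrier G)"
      using bij autoD(2)[OF f] \<eta> by (auto simp: iso_def intro!: bij_betw_trans)
    then show "bij_betw (\<Psi> f) (carrier G) (carrier G)"
      by (rule bij_betw_cong[THEN iffD1, rotated]) (simp add: \<Psi>_def)
  qed (simp add: \<Psi>_def)
  show ?thesis
  proof (rule that)
    show "\<Theta> \<in> iso (AutoGroup G) (AutoGroup H)"
    proof (rule isoI)
      show "\<Theta> \<in> hom (AutoGroup G) (AutoGroup H)"
      proof (rule homI)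
        fix f g assume "f \<in> carrier (AutoGroup G)" "g \<in> carrier (AutoGroup G)"
        then have fg: "f \<in> auto G" "g \<in> auto G" by (auto simp: AutoGroup_carrier)
        then show "\<Theta> (f \<otimes>\<^bsub>AutoGroup G\<^esub> g) = \<Theta> f \<otimes>\<^bsub>AutoGroup H\<^esub> \<Theta> g"
          using auto_closed[OF fg(2)]
          by (auto simp: AutoGroup_mult \<Theta>) (auto simp: \<Theta>_def compose_def)
      qed (simp add: AutoGroup_carrier \<Theta>)
      show "bij_betw \<Theta> (carrier (AutoGroup G)) (carrier (AutoGroup H))"
        unfolding AutoGroup_carrier
      proof (rule bij_betw_byWitness[where f' = \<Psi>])
        show "\<forall>f\<in>auto G. \<Psi> (\<Theta> f) = f"
          using auto_closed autoD(3) by (fastforce simp: \<Theta>_def \<Psi>_def fun_eq_iff extensional_def)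
        show "\<forall>f\<in>auto H. \<Theta> (\<Psi> f) = f"
          using auto_closed autoD(3) by (fastforce simp: \<Theta>_def \<Psi>_def fun_eq_iff extensional_def)
      qed (use \<Theta> \<Psi> in auto)
    qed
    show "\<Theta> (inner G g) = inner H (\<theta> g)" if "g \<in> carrier G" for g
      using that by (auto simp: \<Theta>_def inner_def)
  qed
qed

text \<open>Transport to the automorphisms of \<open>H\<close>, followed by the projection modulo
  \<open>Inn H\<close>, is onto with kernel \<open>Inn G\<close>; the first isomorphism theorem does
  the rest.\<close>

lemma OutGroup_iso:
  assumes "group H" "G \<cong> H"
  shows "OutGroup G \<cong> OutGroup H"
proof -
  obtain \<theta> where \<theta>: "\<theta> \<in> iso G H" using assms(2) by (auto simp: is_iso_def)
  obtain \<Theta> where \<Theta>: "\<Theta> \<in> iso (AutoGroup G) (AutoGroup H)"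
    and \<Theta>_inner: "\<And>g. g \<in> carrier G \<Longrightarrow> \<Theta> (inner G g) = inner H (\<theta> g)"
    using AutoGroup_iso[OF assms(1) \<theta>] by metis
  interpret H: group H by fact
  interpret A: group "AutoGroup G" by (rule AutoGroup)
  interpret B: group "AutoGroup H" by (rule H.AutoGroup)
  interpret \<Theta>: group_hom "AutoGroup G" "AutoGroup H" \<Theta>
    using \<Theta> by (simp add: iso_def group_hom.intro group_hom_axioms.intro A.is_group B.is_group)
  interpret I: normal "Inn H" "AutoGroup H" by (rule H.Inn_normal)
  interpret Q: group "OutGroup H" unfolding OutGroup_def by (rule I.factorgroup_is_group)
  define q where "q f = Inn H #>\<^bsub>AutoGroup H\<^esub> \<Theta> f" for f
  have "q \<in> hom (AutoGroup G) (OutGroup H)"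
    unfolding OutGroup_def q_def using Group.hom_compose[OF \<Theta>.homh I.r_coset_hom_Mod] by (simp add: comp_def)
  then interpret q: group_hom "AutoGroup G" "OutGroup H" q
    by (simp add: group_hom.intro group_hom_axioms.intro A.is_group Q.is_group)
  have "\<Theta> ` carrier (AutoGroup G) = carrier (AutoGroup H)"
    using \<Theta> by (auto simp: iso_def bij_betw_def)
  then have "q ` carrier (AutoGroup G) = carrier (OutGroup H)"
    by (simp add: OutGroup_def carrier_FactGroup q_def flip: image_image)
  moreover have "kernel (AutoGroup G) (OutGroup H) q = Inn G"
  proof -
    have "q f = \<one>\<^bsub>OutGroup H\<^esub> \<longleftrightarrow> f \<in> Inn G" if f: "f \<in> carrier (AutoGroup G)" for f
    proof -
      have "q f = \<one>\<^bsub>OutGroup H\<^esub> \<longleftrightarrow> \<Theta> f \<in> Inn H"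
        unfolding OutGroup_def q_def one_FactGroup
        using f I.subgroup_axioms B.coset_join1 B.coset_join2 I.subset
        by (metis \<Theta>.hom_closed)
      also have "\<dots> \<longleftrightarrow> (\<exists>g\<in>carrier G. \<Theta> f = \<Theta> (inner G g))"
      proof -
        have "carrier H = \<theta> ` carrier G" using \<theta> by (auto simp: iso_def bij_betw_def)
        then show ?thesis using \<Theta>_inner by (auto simp: Inn_eq)
      qed
      also have "\<dots> \<longleftrightarrow> f \<in> Inn G"
      proof -
        have "inj_on \<Theta> (auto G)" using \<Theta> by (simp add: iso_def bij_betw_def AutoGroup_carrier)
        then show ?thesis using f inner_auto
          by (auto simp: Inn_eq AutoGroup_carrier inj_on_eq_iff)
      qed
      finally show ?thesis .
    qed
    then show ?thesis
      using normal_imp_subgroup[OF Inn_normal, THEN subgroup.subset] by (auto simp: kernel_def)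
  qed
  ultimately show ?thesis
    using q.FactGroup_iso unfolding OutGroup_def by (simp add: OutGroup_def)
qed

end

text \<open>The image of \<open>S\<close> need not normalise that of \<open>E\<close>: by
  \<open>conj\<close>, conjugates lie only in \<open>I\<close> times the image of \<open>E\<close>.
  So the product of \<open>I\<close> and \<open>E\<close> is formed first and \<open>S\<close> acts
  on all of it. Modulo \<open>I\<close> the defect disappears, and \<open>S\<close> acts on
  \<open>E\<close> itself.\<close>

lemma normal_tower_semidirect:
  assumes A: "group A" and I: "I \<lhd> A" and L: "group L" and E: "group E" and S: "group S"
    and j: "j \<in> hom L A" "inj_on j (carrier L)" "j ` carrier L = I"
    and e: "e \<in> hom E A" and s: "s \<in> hom S A"
    and eI: "\<And>v. v \<in> carrier E \<Longrightarrow> e v \<in> I \<Longrightarrow> v = \<one>\<^bsub>E\<^esub>"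
    and sIE: "\<And>g v p. g \<in> I \<Longrightarrow> v \<in> carrier E \<Longrightarrow> p \<in> carrier S \<Longrightarrow> g \<otimes>\<^bsub>A\<^esub> e v = s p \<Longrightarrow> p = \<one>\<^bsub>S\<^esub>"
    and conj: "\<And>v p. v \<in> carrier E \<Longrightarrow> p \<in> carrier S \<Longrightarrow>
      \<exists>g\<in>I. \<exists>w\<in>carrier E. s p \<otimes>\<^bsub>A\<^esub> e v \<otimes>\<^bsub>A\<^esub> inv\<^bsub>A\<^esub> s p = g \<otimes>\<^bsub>A\<^esub> e w"
    and gen: "\<And>a. a \<in> carrier A \<Longrightarrow>
      \<exists>g\<in>I. \<exists>v\<in>carrier E. \<exists>p\<in>carrier S. a = g \<otimes>\<^bsub>A\<^esub> e v \<otimes>\<^bsub>A\<^esub> s p"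
  shows "\<exists>\<phi> \<psi>. \<phi> \<in> hom E (AutoGroup L) \<and> \<psi> \<in> hom S (AutoGroup (semidirect_product L E \<phi>)) \<and>
      A \<cong> semidirect_product (semidirect_product L E \<phi>) S \<psi>"
    and "\<exists>\<chi>. \<chi> \<in> hom S (AutoGroup E) \<and> A Mod I \<cong> semidirect_product E S \<chi>"
proof -
  interpret A: group A by fact
  interpret I: normal I A by fact
  interpret L: group L by fact
  interpret E: group E by fact
  interpret S: group S by fact
  interpret e: group_hom E A e by (simp add: e group_hom.intro group_hom_axioms.intro A E)
  interpret s: group_hom S A s by (simp add: s group_hom.intro group_hom_axioms.intro A S)
  have e_inj: "inj_on e (carrier E)"
    unfolding e.inj_on_one_iff using eI I.one_closed by auto
  have s_I: "p = \<one>\<^bsub>S\<^esub>" if "p \<in> carrier S" "s p \<in> I" for p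
    using sIE[of "s p" "\<one>\<^bsub>E\<^esub>" p] that I.subset by auto
  have s_inj: "inj_on s (carrier S)"
    unfolding s.inj_on_one_iff using s_I I.one_closed by auto
  have I_conj: "a \<otimes>\<^bsub>A\<^esub> g \<otimes>\<^bsub>A\<^esub> inv\<^bsub>A\<^esub> a \<in> I" if "a \<in> carrier A" "g \<in> I" for a g
    using that by (rule I.inv_op_closed2)
  obtain \<phi> where \<phi>: "\<phi> \<in> hom E (AutoGroup L)" "group (semidirect_product L E \<phi>)"
    and f: "(\<lambda>p. j (fst p) \<otimes>\<^bsub>A\<^esub> e (snd p)) \<in> hom (semidirect_product L E \<phi>) A"
      "inj_on (\<lambda>p. j (fst p) \<otimes>\<^bsub>A\<^esub> e (snd p)) (carrier (semidirect_product L E \<phi>))"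
  proof (rule semidirect_product_hom[OF A L E j(1,2) e e_inj])
    show "e v \<otimes>\<^bsub>A\<^esub> j x \<otimes>\<^bsub>A\<^esub> inv\<^bsub>A\<^esub> e v \<in> j ` carrier L"
      if "x \<in> carrier L" "v \<in> carrier E" for x v
      unfolding j(3) by (rule I_conj) (use that j(3) in auto)
    show "v = \<one>\<^bsub>E\<^esub>" if "x \<in> carrier L" "v \<in> carrier E" "j x = e v" for x v
      using that eI[of v] j(3) by (metis image_eqI)
  qed
  let ?f = "\<lambda>p. j (fst p) \<otimes>\<^bsub>A\<^esub> e (snd p)" and ?P = "semidirect_product L E \<phi>"
  have f_img: "?f ` carrier ?P = {g \<otimes>\<^bsub>A\<^esub> e v | g v. g \<in> I \<and> v \<in> carrier E}"
    unfolding j(3)[symmetric] by (force simp: semidirect_product_def)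
  obtain \<psi> where \<psi>: "\<psi> \<in> hom S (AutoGroup ?P)" "group (semidirect_product ?P S \<psi>)"
    and h: "(\<lambda>p. ?f (fst p) \<otimes>\<^bsub>A\<^esub> s (snd p)) \<in> hom (semidirect_product ?P S \<psi>) A"
      "inj_on (\<lambda>p. ?f (fst p) \<otimes>\<^bsub>A\<^esub> s (snd p)) (carrier (semidirect_product ?P S \<psi>))"
  proof (rule semidirect_product_hom[OF A \<phi>(2) S f s s_inj])
    fix x p assume x: "x \<in> carrier ?P" and p: "p \<in> carrier S"
    then obtain g v where gv: "?f x = g \<otimes>\<^bsub>A\<^esub> e v" "g \<in> I" "v \<in> carrier E"
      using f_img by blast
    obtain g' w where gw: "g' \<in> I" "w \<in> carrier E"
      "s p \<otimes>\<^bsub>A\<^esub> e v \<otimes>\<^bsub>A\<^esub> inv\<^bsub>A\<^esub> s p = g' \<otimes>\<^bsub>A\<^esub> e w"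
      using conj[OF gv(3) p] by blast
    have c: "g \<in> carrier A" "g' \<in> carrier A" "e v \<in> carrier A" "e w \<in> carrier A" "s p \<in> carrier A"
      using gv gw p I.subset by auto
    \<comment> \<open>Of the two conjugates, the first lies in \<open>I\<close> by normality and the
      second in \<open>I\<close> times the image of \<open>E\<close> by \<open>conj\<close>.\<close>
    have "s p \<otimes>\<^bsub>A\<^esub> ?f x \<otimes>\<^bsub>A\<^esub> inv\<^bsub>A\<^esub> s p =
        (s p \<otimes>\<^bsub>A\<^esub> g \<otimes>\<^bsub>A\<^esub> inv\<^bsub>A\<^esub> s p) \<otimes>\<^bsub>A\<^esub> (s p \<otimes>\<^bsub>A\<^esub> e v \<otimes>\<^bsub>A\<^esub> inv\<^bsub>A\<^esub> s p)"
      unfolding gv(1) using c by (simp only: A.conj_closed_mult)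
    also have "\<dots> = (s p \<otimes>\<^bsub>A\<^esub> g \<otimes>\<^bsub>A\<^esub> inv\<^bsub>A\<^esub> s p) \<otimes>\<^bsub>A\<^esub> g' \<otimes>\<^bsub>A\<^esub> e w"
      unfolding gw(3) using c by (simp add: A.m_assoc del: s.hom_inv)
    finally show "s p \<otimes>\<^bsub>A\<^esub> ?f x \<otimes>\<^bsub>A\<^esub> inv\<^bsub>A\<^esub> s p \<in> ?f ` carrier ?P"
      unfolding f_img using I_conj[OF c(5) gv(2)] gw(1,2) I.m_closed by blast
    show "p = \<one>\<^bsub>S\<^esub>" if "?f x = s p"
      using sIE[OF gv(2,3) p] that gv(1) by simp
  qed
  let ?h = "\<lambda>p. ?f (fst p) \<otimes>\<^bsub>A\<^esub> s (snd p)" and ?PS = "semidirect_product ?P S \<psi>"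
  have "a \<in> ?h ` carrier ?PS" if a: "a \<in> carrier A" for a
  proof -
    obtain g v p where *: "g \<in> I" "v \<in> carrier E" "p \<in> carrier S" "a = g \<otimes>\<^bsub>A\<^esub> e v \<otimes>\<^bsub>A\<^esub> s p"
      using gen[OF a] by blast
    then have "g \<otimes>\<^bsub>A\<^esub> e v \<in> ?f ` carrier ?P" unfolding f_img by blast
    then obtain x where "x \<in> carrier ?P" "g \<otimes>\<^bsub>A\<^esub> e v = ?f x" by blast
    then have "a = ?h (x, p)" "(x, p) \<in> carrier ?PS"
      using * by (simp_all add: semidirect_product_def)
    then show ?thesis by (rule image_eqI)
  qed
  then have "?h ` carrier ?PS = carrier A" using h(1) by (auto dest: hom_in_carrier)
  then have "?PS \<cong> A"
    using h by (intro is_isoI[of ?h] isoI) (auto simp: bij_betw_def)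
  then have "A \<cong> ?PS" by (rule group.iso_sym[OF \<psi>(2)])
  then show "\<exists>\<phi> \<psi>. \<phi> \<in> hom E (AutoGroup L) \<and> \<psi> \<in> hom S (AutoGroup (semidirect_product L E \<phi>)) \<and>
      A \<cong> semidirect_product (semidirect_product L E \<phi>) S \<psi>"
    using \<phi>(1) \<psi>(1) by blast

  let ?q = "\<lambda>a. I #>\<^bsub>A\<^esub> a"
  interpret Q: group "A Mod I" by (rule I.factorgroup_is_group)
  interpret q: group_hom A "A Mod I" ?q
    by (simp add: I.r_coset_hom_Mod group_hom.intro group_hom_axioms.intro A Q.is_group)
  have q_one: "?q a = \<one>\<^bsub>A Mod I\<^esub> \<longleftrightarrow> a \<in> I" if "a \<in> carrier A" for a
    unfolding one_FactGroup
    using that I.subset A.coset_join1[OF _ _ I.subgroup_axioms] A.coset_join2[OF _ I.subgroup_axioms] by blast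
  have qe: "?q \<circ> e \<in> hom E (A Mod I)" and qs: "?q \<circ> s \<in> hom S (A Mod I)"
    by (rule Group.hom_compose[OF e I.r_coset_hom_Mod], rule Group.hom_compose[OF s I.r_coset_hom_Mod])
  interpret qe: group_hom E "A Mod I" "?q \<circ> e"
    by (simp add: qe group_hom.intro group_hom_axioms.intro E Q.is_group)
  interpret qs: group_hom S "A Mod I" "?q \<circ> s"
    by (simp add: qs group_hom.intro group_hom_axioms.intro S Q.is_group)
  have qe_inj: "inj_on (?q \<circ> e) (carrier E)"
    unfolding qe.inj_on_one_iff using q_one eI by auto
  have qs_inj: "inj_on (?q \<circ> s) (carrier S)"
    unfolding qs.inj_on_one_iff using q_one s_I by auto
  have q_I: "?q (g \<otimes>\<^bsub>A\<^esub> a) = ?q a" if "g \<in> I" "a \<in> carrier A" for g a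
  proof -
    have "g \<in> carrier A" using that I.subset by auto
    then have "?q (g \<otimes>\<^bsub>A\<^esub> a) = \<one>\<^bsub>A Mod I\<^esub> \<otimes>\<^bsub>A Mod I\<^esub> ?q a"
      using q.hom_mult[of g a] q_one[of g] that by metis
    then show ?thesis using q.hom_closed[OF that(2)] by (simp only: Q.l_one)
  qed
  obtain \<chi> where \<chi>: "\<chi> \<in> hom S (AutoGroup E)" "group (semidirect_product E S \<chi>)"
    and k: "(\<lambda>p. (?q \<circ> e) (fst p) \<otimes>\<^bsub>A Mod I\<^esub> (?q \<circ> s) (snd p)) \<in> hom (semidirect_product E S \<chi>) (A Mod I)"
      "inj_on (\<lambda>p. (?q \<circ> e) (fst p) \<otimes>\<^bsub>A Mod I\<^esub> (?q \<circ> s) (snd p)) (carrier (semidirect_product E S \<chi>))"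
  proof (rule semidirect_product_hom[OF Q.is_group E S qe qe_inj qs qs_inj])
    fix v p assume v: "v \<in> carrier E" and p: "p \<in> carrier S"
    obtain g w where gw: "g \<in> I" "w \<in> carrier E"
      "s p \<otimes>\<^bsub>A\<^esub> e v \<otimes>\<^bsub>A\<^esub> inv\<^bsub>A\<^esub> s p = g \<otimes>\<^bsub>A\<^esub> e w"
      using conj[OF v p] by blast
    have c: "s p \<in> carrier A" "e v \<in> carrier A" "e w \<in> carrier A" "inv\<^bsub>A\<^esub> s p \<in> carrier A" using v p gw by auto
    have "?q (s p) \<otimes>\<^bsub>A Mod I\<^esub> ?q (e v) \<otimes>\<^bsub>A Mod I\<^esub> inv\<^bsub>A Mod I\<^esub> ?q (s p) =
        ?q (s p \<otimes>\<^bsub>A\<^esub> e v \<otimes>\<^bsub>A\<^esub> inv\<^bsub>A\<^esub> s p)"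
      using c by (simp only: q.hom_mult q.hom_inv A.m_closed)
    also have "\<dots> = ?q (e w)" unfolding gw(3) using gw c q_I by blast
    finally show "(?q \<circ> s) p \<otimes>\<^bsub>A Mod I\<^esub> (?q \<circ> e) v \<otimes>\<^bsub>A Mod I\<^esub> inv\<^bsub>A Mod I\<^esub> (?q \<circ> s) p
        \<in> (?q \<circ> e) ` carrier E"
      unfolding comp_def using gw(2) by blast
    show "p = \<one>\<^bsub>S\<^esub>" if "(?q \<circ> e) v = (?q \<circ> s) p"
    proof -
      \<comment> \<open>Equality of the two cosets puts \<open>s p\<close> into \<open>I\<close>
        times \<open>e v\<close>, which is the situation excluded by \<open>sIE\<close> unless
        \<open>p\<close> is trivial.\<close>
      have "?q (s p \<otimes>\<^bsub>A\<^esub> inv\<^bsub>A\<^esub> e v) = ?q (s p) \<otimes>\<^bsub>A Mod I\<^esub> inv\<^bsub>A Mod I\<^esub> ?q (s p)"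
        using that c A.inv_closed[OF c(2)] by (simp only: q.hom_mult q.hom_inv comp_def)
      also have "\<dots> = \<one>\<^bsub>A Mod I\<^esub>" using q.hom_closed[OF c(1)] by (rule Q.r_inv)
      finally have "s p \<otimes>\<^bsub>A\<^esub> inv\<^bsub>A\<^esub> e v \<in> I"
        using q_one[of "s p \<otimes>\<^bsub>A\<^esub> inv\<^bsub>A\<^esub> e v"] c by blast
      moreover have "s p \<otimes>\<^bsub>A\<^esub> inv\<^bsub>A\<^esub> e v \<otimes>\<^bsub>A\<^esub> e v = s p"
        using c by (simp add: A.m_assoc del: e.hom_inv)
      ultimately show ?thesis using sIE v p by blast
    qed
  qed
  let ?k = "\<lambda>p. (?q \<circ> e) (fst p) \<otimes>\<^bsub>A Mod I\<^esub> (?q \<circ> s) (snd p)" and ?ES = "semidirect_product E S \<chi>"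
  have "x \<in> ?k ` carrier ?ES" if x: "x \<in> carrier (A Mod I)" for x
  proof -
    obtain a where a: "a \<in> carrier A" "x = ?q a" using x by (auto simp: carrier_FactGroup)
    obtain g v p where *: "g \<in> I" "v \<in> carrier E" "p \<in> carrier S" "a = g \<otimes>\<^bsub>A\<^esub> e v \<otimes>\<^bsub>A\<^esub> s p"
      using gen[OF a(1)] by blast
    have c: "g \<in> carrier A" "e v \<in> carrier A" "s p \<in> carrier A" using * I.subset by auto
    have "?q a = ?q (g \<otimes>\<^bsub>A\<^esub> (e v \<otimes>\<^bsub>A\<^esub> s p))" unfolding *(4) using c by (simp only: A.m_assoc)
    also have "\<dots> = ?q (e v \<otimes>\<^bsub>A\<^esub> s p)" using q_I[OF *(1)] c by blast
    also have "\<dots> = ?k (v, p)" using c by (simp only: q.hom_mult fst_conv snd_conv comp_def)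
    finally have "x = ?k (v, p)" using a(2) by simp
    moreover have "(v, p) \<in> carrier ?ES" using * by (simp add: semidirect_product_def)
    ultimately show ?thesis by (rule image_eqI)
  qed
  then have "?k ` carrier ?ES = carrier (A Mod I)" using hom_in_carrier[OF k(1)] by blast
  then have "?ES \<cong> A Mod I"
    using k by (intro is_isoI[of ?k] isoI) (simp_all only: bij_betw_def simp_thms)
  then have "A Mod I \<cong> ?ES" by (rule group.iso_sym[OF \<chi>(2)])
  then show "\<exists>\<chi>. \<chi> \<in> hom S (AutoGroup E) \<and> A Mod I \<cong> semidirect_product E S \<chi>"
    using \<chi>(1) by blast
qed

section \<open>Automorphisms of the extended free products\<close>

lemma auto_KG_eq:
  assumes "f \<in> auto (KG k)" "g \<in> auto (KG k)" "f kt = g kt"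
    and "\<And>i. i \<in> {1..k} \<Longrightarrow> f (ka i) = g (ka i)"
  shows "f = g"
proof (rule extensionalityI)
  show "f \<in> extensional (carrier (KG k))" "g \<in> extensional (carrier (KG k))"
    using assms autoD(3) by auto
  show "f x = g x" if "x \<in> carrier (KG k)" for x
    using KG_hom_eq[OF group_KG autoD(1)[OF assms(1)] autoD(1)[OF assms(2)] assms(3,4) that] .
qed

definition saut :: "nat \<Rightarrow> (nat \<Rightarrow> nat) \<Rightarrow> (nat \<Rightarrow> bool) \<Rightarrow> letter list \<times> bool \<Rightarrow> letter list \<times> bool" where
  "saut k \<sigma> \<epsilon> = (\<lambda>x\<in>carrier (KG k). (map (sperm \<sigma> \<epsilon>) (fst x), snd x))"

lemma saut_kt [simp]: "saut k \<sigma> \<epsilon> kt = kt"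
  by (simp add: saut_def)

lemma saut_ka [simp]: "i \<in> {1..k} \<Longrightarrow> saut k \<sigma> \<epsilon> (ka i) = ([(\<sigma> i, \<epsilon> i)], False)"
  by (simp add: saut_def sperm_def)

lemma saut_closed: "\<sigma> permutes {1..k} \<Longrightarrow> x \<in> carrier (KG k) \<Longrightarrow> saut k \<sigma> \<epsilon> x \<in> carrier (KG k)"
  by (simp add: saut_def KG_carrier rwords_sperm)

text \<open>Signs are read at the source index, so the outer map reads its sign at
  \<open>\<sigma>' i\<close>, where the inner map has put the letter.\<close>

lemma saut_compose:
  assumes "\<sigma> permutes {1..k}" "\<sigma>' permutes {1..k}"
  shows "compose (carrier (KG k)) (saut k \<sigma> \<epsilon>) (saut k \<sigma>' \<epsilon>') =
    saut k (\<sigma> \<circ> \<sigma>') (\<lambda>i. \<epsilon>' i \<noteq> \<epsilon> (\<sigma>' i))"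
  using saut_closed[OF assms(2)]
  by (auto simp: compose_def saut_def sperm_def fun_eq_iff)

lemma saut_id: "saut k id (\<lambda>_. False) = (\<lambda>x\<in>carrier (KG k). x)"
  by (auto simp: saut_def sperm_def map_idI fun_eq_iff)

lemma saut_auto:
  assumes \<sigma>: "\<sigma> permutes {1..k}" shows "saut k \<sigma> \<epsilon> \<in> auto (KG k)"
proof (rule autoI)
  show "saut k \<sigma> \<epsilon> \<in> hom (KG k) (KG k)"
  proof (rule homI)
    interpret K: group "KG k" by (rule group_KG)
    fix x y assume "x \<in> carrier (KG k)" "y \<in> carrier (KG k)"
    moreover from this have "x \<otimes>\<^bsub>KG k\<^esub> y \<in> carrier (KG k)" by simp
    ultimately show "saut k \<sigma> \<epsilon> (x \<otimes>\<^bsub>KG k\<^esub> y) = saut k \<sigma> \<epsilon> x \<otimes>\<^bsub>KG k\<^esub> saut k \<sigma> \<epsilon> y"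
      by (cases x; cases y) (simp add: saut_def KG_mult wmult_sperm[OF permutes_inj[OF \<sigma>]] comp_def)
  qed (rule saut_closed[OF \<sigma>])
  define \<tau> where "\<tau> = inv_into UNIV \<sigma>"
  have \<tau>: "\<tau> permutes {1..k}" "\<sigma> \<circ> \<tau> = id" "\<tau> \<circ> \<sigma> = id"
    using \<sigma> by (auto simp: \<tau>_def permutes_inv permutes_inv_o)
  \<comment> \<open>The inverse undoes at \<open>i\<close> the sign that was acquired at the
    preimage \<open>\<tau> i\<close>.\<close>
  let ?\<delta> = "\<lambda>i. \<epsilon> (\<tau> i)"
  have ts: "\<tau> (\<sigma> i) = i" "\<sigma> (\<tau> i) = i" for i
    using \<tau>(2,3) by (auto simp: fun_eq_iff)
  have 1: "compose (carrier (KG k)) (saut k \<sigma> \<epsilon>) (saut k \<tau> ?\<delta>) = saut k id (\<lambda>_. False)"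
    using \<sigma> \<tau> by (simp add: saut_compose)
  have 2: "compose (carrier (KG k)) (saut k \<tau> ?\<delta>) (saut k \<sigma> \<epsilon>) = saut k id (\<lambda>_. False)"
    using \<sigma> \<tau> by (simp add: saut_compose ts)
  show "bij_betw (saut k \<sigma> \<epsilon>) (carrier (KG k)) (carrier (KG k))"
  proof (rule bij_betw_byWitness[where f' = "saut k \<tau> ?\<delta>"])
    show "\<forall>x\<in>carrier (KG k). saut k \<tau> ?\<delta> (saut k \<sigma> \<epsilon> x) = x"
      using fun_cong[OF 2] by (simp add: compose_def saut_id) metis
    show "\<forall>x\<in>carrier (KG k). saut k \<sigma> \<epsilon> (saut k \<tau> ?\<delta> x) = x"
      using fun_cong[OF 1] by (simp add: compose_def saut_id) metis
  qed (use saut_closed \<sigma> \<tau> in blast)+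
qed (simp add: saut_def)

section \<open>Palindromes, involutions and elements of order three\<close>

lemma palindrome_cases:
  assumes "rev w = w"
  obtains "w = []" | c where "w = [c]" | c v where "w = c # v @ [c]" "rev v = v"
proof -
  consider "w = []" | c where "w = [c]" | c v d where "w = c # v @ [d]"
  proof (cases w)
    case Nil
    then show ?thesis by (rule that(1))
  next
    case (Cons c w')
    then show ?thesis by (cases w' rule: rev_cases) (simp_all add: that(2,3))
  qed
  then show ?thesis
  proof cases
    case 1
    then show ?thesis by (rule that(1))
  next
    case 2
    then show ?thesis by (rule that(2))
  next
    case (3 c v d)
    have "d # rev v @ [c] = c # v @ [d]"
      using assms unfolding 3 rev.simps rev_append append.simps .
    then have dc: "d = c" and v: "rev v = v" by (blast dest: list.inject[THEN iffD1] append1_eq_conv[THEN iffD1])+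
    show ?thesis by (rule that(3)[OF 3[unfolded dc] v])
  qed
qed

text \<open>Stripping equal outer letters must end at a single letter: an empty centre would leave
  two equal letters adjacent, which a reduced word excludes.\<close>

lemma reduced_palindrome_odd:
  assumes "w \<in> rwords k" "rev w = w" "w \<noteq> []"
  shows "\<exists>u l. w = u @ [l] @ rev u"
  using assms
proof (induction "length w" arbitrary: w rule: less_induct)
  case less
  from \<open>rev w = w\<close> show ?case
  proof (cases rule: palindrome_cases)
    case 1
    then show ?thesis using less.prems by simp
  next
    case (2 c)
    then show ?thesis by (intro exI[of _ "[]"] exI[of _ c]) simp
  next
    case (3 c v)
    have v: "v \<noteq> []" "v \<in> rwords k" "length v < length w"
      using less.prems(1) unfolding 3(1) by (auto simp: rwords_Cons rwords_append)
    obtain u l where "v = u @ [l] @ rev u" using less.hyps[OF v(3) v(2) 3(2) v(1)] by blast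
    then have "w = (c # u) @ [l] @ rev (c # u)" using 3(1) by simp
    then show ?thesis by blast
  qed
qed

lemma wmult_eq_Nil:
  assumes "u \<in> rwords k" "v \<in> rwords k" "wmult u v = []"
  shows "u = winv v"
proof -
  interpret K: group "KG k" by (rule group_KG)
  have "(u, False) \<otimes>\<^bsub>KG k\<^esub> (v, False) = \<one>\<^bsub>KG k\<^esub>" using assms(3) by (simp add: KG_mult KG_one)
  then have "inv\<^bsub>KG k\<^esub> (v, False) = (u, False)"
    using assms by (intro K.inv_equality) (auto simp: KG_carrier)
  then show ?thesis using KG_inv[OF assms(2)] by simp
qed

text \<open>For a palindrome of length at least three, squaring only merges the two letters
  that meet in the middle, so the square is too long to be the inverse.\<close>

lemma palindrome_cube:
  assumes w: "w \<in> rwords k" "rev w = w" "w \<noteq> []" and cube: "wmult w w = winv w"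
  shows "\<exists>l. w = [l]"
  using \<open>rev w = w\<close>
proof (cases rule: palindrome_cases)
  case (3 c v)
  have v: "v \<noteq> []" using w 3 by (auto simp: rwords_Cons)
  have cv: "c # v \<in> rwords k" "(c # v) @ [c] \<in> rwords k" 
    using w 3 rwords_append[of "c # v" "[c]" k] by auto
  have "fst (hd v) \<noteq> fst c" using cv(1) v by (auto simp: rwords_Cons)
  moreover have "fst (last v) \<noteq> fst c" using cv(2) v by (auto simp: rwords_append rwords_Cons)
  moreover have "flip True c # v @ [c] \<in> rwords k"
    using w(1) 3 by (simp add: rwords_Cons)
  ultimately have red: "(c # v) @ (flip True c # v @ [c]) \<in> rwords k"
    using cv v unfolding rwords_append[of "c # v" "flip True c # v @ [c]"] by auto
  have "wmult w w = wmult (c # v) (redcons c (c # v @ [c]))"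
    unfolding 3(1) by (simp add: wmult_append)
  also have "redcons c (c # v @ [c]) = flip True c # v @ [c]" by (simp add: flip_def)
  also have "wmult (c # v) (flip True c # v @ [c]) = (c # v) @ (flip True c # v @ [c])"
    using red by (rule wmult_reduced)
  finally have "length (wmult w w) = length w + length v + 1" using 3 by simp
  then show ?thesis using cube by (simp add: winv_def)
qed (use w in auto)

lemma involution_conj_kt:
  assumes "(w, True) \<in> carrier (KG k)" "(w, True) \<otimes>\<^bsub>KG k\<^esub> (w, True) = \<one>\<^bsub>KG k\<^esub>"
  shows "\<exists>g\<in>carrier (KG k). (w, True) = g \<otimes>\<^bsub>KG k\<^esub> kt \<otimes>\<^bsub>KG k\<^esub> inv\<^bsub>KG k\<^esub> g"
proof -
  interpret K: group "KG k" by (rule group_KG)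
  have w: "w \<in> rwords k" "wmult w (map (flip True) w) = []"
    using assms by (auto simp: KG_carrier KG_mult KG_one)
  then have "w = winv (map (flip True) w)" by (intro wmult_eq_Nil) auto
  then have pal: "rev w = w" by (simp add: winv_def)
  show ?thesis
  proof (cases "w = []")
    case True
    then show ?thesis by (intro bexI[of _ "\<one>\<^bsub>KG k\<^esub>"]) simp_all
  next
    case False
    then obtain u l where ul: "w = u @ [l] @ rev u" using reduced_palindrome_odd w(1) pal by blast
    \<comment> \<open>Conjugating \<open>kt\<close> by a word \<open>v\<close> gives
      \<open>v (rev v) t\<close>. The middle letter \<open>l\<close> is the square of its inverse,
      so taking \<open>v\<close> to be \<open>u l^-1\<close> produces
      \<open>u l (rev u)\<close>.\<close>
    let ?v = "u @ [flip True l]"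
    have v: "?v \<in> rwords k"
      using w(1) unfolding ul by (auto simp: rwords_append rwords_Cons)
    have "(?v, False) \<otimes>\<^bsub>KG k\<^esub> kt \<otimes>\<^bsub>KG k\<^esub> inv\<^bsub>KG k\<^esub> (?v, False) = (wmult ?v (rev ?v), True)"
      using KG_inv[OF v, of False] wmult_Nil_right[OF v] by (simp add: KG_mult map_flip_True_winv)
    also have "wmult ?v (rev ?v) = wmult u (l # rev u)"
      by (simp add: wmult_append flip_def)
    also have "wmult u (l # rev u) = w"
      using w(1) ul by (simp add: wmult_reduced)
    finally show ?thesis using v by (intro bexI[of _ "(?v, False)"]) (auto simp: KG_carrier)
  qed
qed

text \<open>Commuting with \<open>kt\<close> means that inverting every letter leaves the word
  unchanged, but no letter equals its inverse.\<close>

lemma KG_centralizer_kt: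
  assumes "g \<in> carrier (KG k)" "g \<otimes>\<^bsub>KG k\<^esub> kt = kt \<otimes>\<^bsub>KG k\<^esub> g"
  shows "g = \<one>\<^bsub>KG k\<^esub> \<or> g = kt"
proof -
  obtain w s where g: "g = (w, s)" by (cases g)
  have "w = map (flip True) w"
    using assms wmult_Nil_right[of w k] by (auto simp: g KG_mult KG_carrier)
  then have "w = []" by (cases w) auto
  then show ?thesis using g by (cases s) (auto simp: KG_one)
qed

section \<open>Inner signed permutations and the classification of automorphisms\<close>

lemma inv_kt [simp]: "inv\<^bsub>KG k\<^esub> kt = kt"
  by (rule group.inv_equality[OF group_KG]) (simp_all add: kt_kt)

lemma inner_kt_ka:
  assumes "i \<in> {1..k}" shows "inner (KG k) kt (ka i) = ([(i, True)], False)"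
  using assms by (simp add: inner_def KG_mult flip_def)

lemma inner_kt: "inner (KG k) kt = saut k id (\<lambda>_. True)"
proof (rule auto_KG_eq)
  interpret K: group "KG k" by (rule group_KG)
  show "inner (KG k) kt \<in> auto (KG k)" by (rule K.inner_auto) simp
  show "saut k id (\<lambda>_. True) \<in> auto (KG k)" by (rule saut_auto) (rule permutes_id)
  show "inner (KG k) kt kt = saut k id (\<lambda>_. True) kt"
    by (simp add: inner_def kt_kt K.m_assoc)
  show "inner (KG k) kt (ka i) = saut k id (\<lambda>_. True) (ka i)" if "i \<in> {1..k}" for i
    using that by (simp only: inner_kt_ka saut_ka id_apply)
qed

text \<open>A signed permutation fixes \<open>kt\<close>, so \<open>g\<close> centralises
  \<open>kt\<close> and is one of two elements; comparing values at the \<open>ka i\<close> then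
  determines the permutation and the signs.\<close>

lemma saut_eq_inner:
  assumes g: "g \<in> carrier (KG k)" and \<sigma>: "\<sigma> permutes {1..k}" and e: "inner (KG k) g = saut k \<sigma> \<epsilon>"
  shows "\<sigma> = id" "\<And>i. i \<in> {1..k} \<Longrightarrow> \<epsilon> i = (g = kt)" "g = \<one>\<^bsub>KG k\<^esub> \<or> g = kt"
proof -
  interpret K: group "KG k" by (rule group_KG)
  have "g \<otimes>\<^bsub>KG k\<^esub> kt \<otimes>\<^bsub>KG k\<^esub> inv\<^bsub>KG k\<^esub> g = kt"
    using fun_cong[OF e, of kt] g by (simp add: inner_def)
  then have "g \<otimes>\<^bsub>KG k\<^esub> kt = kt \<otimes>\<^bsub>KG k\<^esub> g"
    using g by (metis K.inv_solve_right' K.m_closed kt_closed)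
  then show g': "g = \<one>\<^bsub>KG k\<^esub> \<or> g = kt" by (rule KG_centralizer_kt[OF g])
  have "([(\<sigma> i, \<epsilon> i)], False) = ([(i, g = kt)], False)" if i: "i \<in> {1..k}" for i
  proof -
    have "([(\<sigma> i, \<epsilon> i)], False) = inner (KG k) g (ka i)"
      using fun_cong[OF e, of "ka i"] i by (simp only: saut_ka)
    also have "\<dots> = ([(i, g = kt)], False)"
    proof (cases "g = kt")
      case False
      then have "g = \<one>\<^bsub>KG k\<^esub>" using g' by blast
      then show ?thesis using False ka_closed[OF i] by (simp add: inner_def)
    qed (use inner_kt_ka[OF i] in simp)
    finally show ?thesis .
  qed
  then have *: "\<sigma> i = i \<and> \<epsilon> i = (g = kt)" if "i \<in> {1..k}" for i using that by simp
  then show "\<epsilon> i = (g = kt)" if "i \<in> {1..k}" for i using that by blast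
  show "\<sigma> = id" using * permutes_not_in[OF \<sigma>] by (metis eq_id_iff)
qed

lemma auto_KG_fixing_kt:
  assumes f: "f \<in> auto (KG k)" and ft: "f kt = kt"
  obtains \<sigma> \<epsilon> where "\<sigma> permutes {1..k}" "f = saut k \<sigma> \<epsilon>"
proof -
  interpret K: group "KG k" by (rule group_KG)
  interpret f: group_hom "KG k" "KG k" f
    by (simp add: autoD(1)[OF f] group_hom.intro group_hom_axioms.intro K.is_group)
  have "\<exists>l. fst l \<in> {1..k} \<and> f (ka i) = ([l], False)" if i: "i \<in> {1..k}" for i
  proof -
    obtain w s where fw: "f (ka i) = (w, s)" by (cases "f (ka i)")
    have w: "w \<in> rwords k" using f.hom_closed[OF ka_closed[OF i]] fw by (simp add: KG_carrier)
    have ws: "(w, s) \<in> carrier (KG k)" using w by (simp add: KG_carrier)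
    have c: "(w, s) \<otimes>\<^bsub>KG k\<^esub> (w, s) \<otimes>\<^bsub>KG k\<^esub> (w, s) = \<one>\<^bsub>KG k\<^esub>"
      using arg_cong[OF ka_relations(1)[OF i], of f] ka_closed[OF i] fw by simp
    \<comment> \<open>The exponent of \<open>t\<close> in a cube has the same parity as in the
      element itself.\<close>
    then have s: "s = False" by (simp add: KG_mult KG_one)
    have "inv\<^bsub>KG k\<^esub> (w, s) = (w, s) \<otimes>\<^bsub>KG k\<^esub> (w, s)"
      using c ws by (intro K.inv_equality) auto
    then have cube: "wmult w w = winv w"
      using KG_inv[OF w] s by (simp add: KG_mult)
    have "kt \<otimes>\<^bsub>KG k\<^esub> (w, s) \<otimes>\<^bsub>KG k\<^esub> kt = inv\<^bsub>KG k\<^esub> (w, s)"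
      using arg_cong[OF ka_relations(2)[OF i], of f] ka_closed[OF i] fw ft by simp
    then have "map (flip True) w = winv w"
      using KG_inv[OF w] s wmult_Nil_right[of "map (flip True) w" k] w by (simp add: KG_mult)
    then have "map (flip True) w = map (flip True) (rev w)" by (simp add: winv_def rev_map)
    moreover have "inj (flip True)" by (rule injI) (auto simp: flip_def prod_eq_iff)
    ultimately have "rev w = w" by (simp only: inj_map_eq_map)
    moreover have "w \<noteq> []"
    proof
      assume "w = []"
      then have "f (ka i) = f \<one>\<^bsub>KG k\<^esub>" using fw s f.hom_one by (simp add: KG_one)
      then have "ka i = \<one>\<^bsub>KG k\<^esub>" using auto_inj[OF f] ka_closed[OF i] by blast
      then show False by (simp add: KG_one)
    qed
    ultimately obtain l where "w = [l]" using palindrome_cube[OF w _ _ cube] by blast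
    then show ?thesis using fw s w by (intro exI[of _ l]) (auto simp: rwords_Cons)
  qed
  then obtain L where L: "\<And>i. i \<in> {1..k} \<Longrightarrow> fst (L i) \<in> {1..k}"
    "\<And>i. i \<in> {1..k} \<Longrightarrow> f (ka i) = ([L i], False)" by metis
  \<comment> \<open>Outside the index range the identity is used, as \<open>permutes\<close>
    demands.\<close>
  define \<sigma> where "\<sigma> i = (if i \<in> {1..k} then fst (L i) else i)" for i
  have "inj_on \<sigma> {1..k}"
  proof (rule inj_onI)
    fix i j assume i: "i \<in> {1..k}" and j: "j \<in> {1..k}" and "\<sigma> i = \<sigma> j"
    then have "fst (L i) = fst (L j)" by (simp add: \<sigma>_def)
    \<comment> \<open>Letters with the same index are equal or inverse, so by injectivity of
      \<open>f\<close> the generator \<open>ka i\<close> is \<open>ka j\<close> or its inverse; the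
      latter is never a positive letter.\<close>
    then consider "L i = L j" | "L i = flip True (L j)" by (auto simp: prod_eq_iff)
    then show "i = j"
    proof cases
      case 1
      then have "f (ka i) = f (ka j)" using L i j by simp
      then have "ka i = ka j" using auto_inj[OF f] ka_closed i j by blast
      then show ?thesis by simp
    next
      case 2
      have Lj: "[L j] \<in> rwords k" using L(1)[OF j] by (simp add: rwords_Cons)
      have "f (ka i) = f (inv\<^bsub>KG k\<^esub> ka j)"
        using 2 L(2)[OF i] L(2)[OF j] ka_closed[OF j] KG_inv[OF Lj, of False] by (simp add: winv_def)
      then have "ka i = inv\<^bsub>KG k\<^esub> ka j"
        using auto_inj[OF f] ka_closed[OF i] ka_closed[OF j] K.inv_closed by blast
      then show ?thesis
        using KG_inv[of "[(j, False)]" k False] j by (simp add: winv_def rwords_Cons flip_def)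
    qed
  qed
  moreover have "\<sigma> ` {1..k} \<subseteq> {1..k}" using L(1) by (auto simp: \<sigma>_def)
  ultimately have "bij_betw \<sigma> {1..k} {1..k}"
    by (simp add: bij_betw_def endo_inj_surj)
  then have \<sigma>: "\<sigma> permutes {1..k}" by (rule bij_imp_permutes) (simp only: \<sigma>_def if_False)
  have "f = saut k \<sigma> (\<lambda>i. snd (L i))"
  proof (rule auto_KG_eq[OF f saut_auto[OF \<sigma>]])
    show "f kt = saut k \<sigma> (\<lambda>i. snd (L i)) kt" using ft by simp
    show "f (ka i) = saut k \<sigma> (\<lambda>i. snd (L i)) (ka i)" if i: "i \<in> {1..k}" for i
      using L(2)[OF i] i by (simp only: saut_ka) (simp add: \<sigma>_def)
  qed
  with \<sigma> that show ?thesis by blast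
qed

text \<open>The parity of the exponent of \<open>t\<close> is a homomorphism, realised here as the
  endomorphism \<open>P\<close>. It is trivial on each \<open>f (ka i)\<close>, whose cube is
  trivial; were it trivial on \<open>f kt\<close> too, it would be so on the whole image of
  \<open>f\<close>, against surjectivity.\<close>

lemma auto_KG_involution:
  assumes f: "f \<in> auto (KG k)" shows "snd (f kt)"
proof (rule ccontr)
  assume not: "\<not> snd (f kt)"
  interpret K: group "KG k" by (rule group_KG)
  interpret f: group_hom "KG k" "KG k" f
    by (simp add: autoD(1)[OF f] group_hom.intro group_hom_axioms.intro K.is_group)
  define P :: "letter list \<times> bool \<Rightarrow> letter list \<times> bool" where "P x = ([], snd x)" for x
  have P: "P \<in> hom (KG k) (KG k)"
    by (rule homI) (auto simp: P_def KG_carrier KG_mult split: prod.splits)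
  have *: "(P \<circ> f) x = (\<lambda>_. \<one>\<^bsub>KG k\<^esub>) x" if "x \<in> carrier (KG k)" for x
  proof (rule KG_hom_eq[OF K.is_group _ _ _ _ that])
    show "P \<circ> f \<in> hom (KG k) (KG k)" using autoD(1)[OF f] P by (rule Group.hom_compose)
    show "(\<lambda>_. \<one>\<^bsub>KG k\<^esub>) \<in> hom (KG k) (KG k)" by (simp add: hom_def)
    show "(P \<circ> f) kt = \<one>\<^bsub>KG k\<^esub>" using not by (simp add: P_def KG_one)
    show "(P \<circ> f) (ka i) = \<one>\<^bsub>KG k\<^esub>" if i: "i \<in> {1..k}" for i
    proof -
      have "f (ka i) \<otimes>\<^bsub>KG k\<^esub> f (ka i) \<otimes>\<^bsub>KG k\<^esub> f (ka i) = \<one>\<^bsub>KG k\<^esub>"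
        using arg_cong[OF ka_relations(1)[OF i], of f] ka_closed[OF i] by simp
      then show ?thesis by (cases "f (ka i)") (auto simp: P_def KG_one KG_mult)
    qed
  qed
  obtain x where "x \<in> carrier (KG k)" "f x = kt"
    using autoD(2)[OF f] kt_closed by (metis bij_betw_iff_bijections)
  then show False using *[of x] by (simp add: P_def KG_one)
qed

lemma auto_KG_cases:
  assumes f: "f \<in> auto (KG k)"
  obtains g \<sigma> \<epsilon> where "g \<in> carrier (KG k)" "\<sigma> permutes {1..k}"
    "f = inner (KG k) g \<otimes>\<^bsub>AutoGroup (KG k)\<^esub> saut k \<sigma> \<epsilon>"
proof -
  interpret K: group "KG k" by (rule group_KG)
  interpret A: group "AutoGroup (KG k)" by (rule K.AutoGroup)
  interpret f: group_hom "KG k" "KG k" f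
    by (simp add: autoD(1)[OF f] group_hom.intro group_hom_axioms.intro K.is_group)
  obtain w where w: "f kt = (w, True)" using auto_KG_involution[OF f] by (cases "f kt") auto
  have "(w, True) \<otimes>\<^bsub>KG k\<^esub> (w, True) = \<one>\<^bsub>KG k\<^esub>"
    using arg_cong[OF kt_kt[of k], of f] w by simp
  moreover have "(w, True) \<in> carrier (KG k)" using f.hom_closed[OF kt_closed] w by simp
  ultimately obtain g where g: "g \<in> carrier (KG k)"
    "f kt = g \<otimes>\<^bsub>KG k\<^esub> kt \<otimes>\<^bsub>KG k\<^esub> inv\<^bsub>KG k\<^esub> g"
    using involution_conj_kt w by metis
  let ?i = "inner (KG k) (inv\<^bsub>KG k\<^esub> g)"
  have i: "?i \<in> auto (KG k)" "inner (KG k) g \<in> auto (KG k)" using g by (auto intro: K.inner_auto)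
  \<comment> \<open>Cancels the conjugation that moves \<open>kt\<close>, leaving an automorphism
    that fixes it.\<close>
  define f' where "f' = ?i \<otimes>\<^bsub>AutoGroup (KG k)\<^esub> f"
  have f': "f' \<in> auto (KG k)" using i f A.m_closed by (simp add: f'_def AutoGroup_carrier)
  have "f' kt = ?i (f kt)" using i f by (simp add: f'_def AutoGroup_mult compose_def)
  also have "\<dots> = inv\<^bsub>KG k\<^esub> g \<otimes>\<^bsub>KG k\<^esub> (g \<otimes>\<^bsub>KG k\<^esub> kt \<otimes>\<^bsub>KG k\<^esub> inv\<^bsub>KG k\<^esub> g) \<otimes>\<^bsub>KG k\<^esub> g"
    unfolding g(2) using g(1) by (simp add: inner_def)
  also have "\<dots> = kt" using g(1) by (simp add: K.m_assoc) (simp flip: K.m_assoc)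
  finally obtain \<sigma> \<epsilon> where \<sigma>: "\<sigma> permutes {1..k}" "f' = saut k \<sigma> \<epsilon>"
    using auto_KG_fixing_kt[OF f'] by metis
  have "inner (KG k) g \<otimes>\<^bsub>AutoGroup (KG k)\<^esub> ?i = \<one>\<^bsub>AutoGroup (KG k)\<^esub>"
    using K.inner_mult[OF g(1) K.inv_closed[OF g(1)]] g(1) i
    by (simp add: AutoGroup_mult K.inner_one AutoGroup_one)
  then have "f = inner (KG k) g \<otimes>\<^bsub>AutoGroup (KG k)\<^esub> f'"
    using i f by (simp add: f'_def AutoGroup_carrier flip: A.m_assoc)
  with g(1) \<sigma> that show ?thesis by blast
qed

section \<open>Assembling the automorphism and outer automorphism groups\<close>

lemma saut_cong: "\<sigma> permutes {1..k} \<Longrightarrow> (\<And>i. i \<in> {1..k} \<Longrightarrow> \<epsilon> i = \<delta> i) \<Longrightarrow> saut k \<sigma> \<epsilon> = saut k \<sigma> \<delta>"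
  by (rule auto_KG_eq[of _ k]) (simp_all add: saut_auto)

lemma saut_mult:
  assumes "\<sigma> permutes {1..k}" "\<sigma>' permutes {1..k}"
  shows "saut k \<sigma> \<epsilon> \<otimes>\<^bsub>AutoGroup (KG k)\<^esub> saut k \<sigma>' \<epsilon>' = saut k (\<sigma> \<circ> \<sigma>') (\<lambda>i. \<epsilon>' i \<noteq> \<epsilon> (\<sigma>' i))"
  using assms by (simp add: AutoGroup_mult saut_auto saut_compose)

lemma saut_one: "saut k id (\<lambda>_. False) = \<one>\<^bsub>AutoGroup (KG k)\<^esub>"
  by (simp add: AutoGroup_one saut_id)

text \<open>\<open>Z2pow (k - 1)\<close> is embedded as the sign changes that fix the last generator; they form a
  complement in all sign changes to the simultaneous one, which is conjugation by \<open>kt\<close>.\<close>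

definition zsign :: "nat \<Rightarrow> (nat \<Rightarrow> int) \<Rightarrow> nat \<Rightarrow> bool" where
  "zsign k v i \<longleftrightarrow> 1 \<le> i \<and> i < k \<and> v (i - 1) = 1"

lemma Z2pow_carrier: "v \<in> carrier (Z2pow m) \<longleftrightarrow> v \<in> {..<m} \<rightarrow>\<^sub>E {0..<2}"
  by (simp add: Z2pow_def carrier_integer_mod_group)

lemma group_Z2pow: "group (Z2pow m)"
  by (simp add: Z2pow_def)

lemma zsign_mult:
  assumes "v \<in> carrier (Z2pow (k - 1))" "w \<in> carrier (Z2pow (k - 1))"
  shows "zsign k (v \<otimes>\<^bsub>Z2pow (k - 1)\<^esub> w) i = (zsign k v i \<noteq> zsign k w i)"
proof (cases "1 \<le> i \<and> i < k")
  case True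
  then have i: "i - 1 \<in> {..<k - 1}" by auto
  then have "v (i - 1) \<in> {0..<2}" "w (i - 1) \<in> {0..<2}"
    using assms unfolding Z2pow_carrier by (blast dest: PiE_mem)+
  then have "v (i - 1) = 0 \<or> v (i - 1) = 1" "w (i - 1) = 0 \<or> w (i - 1) = 1" by auto
  with i True show ?thesis by (auto simp: zsign_def Z2pow_def)
qed (auto simp: zsign_def)

lemma zsign_trivial:
  assumes v: "v \<in> carrier (Z2pow (k - 1))" and "\<And>i. i \<in> {1..k} \<Longrightarrow> \<not> zsign k v i"
  shows "v = \<one>\<^bsub>Z2pow (k - 1)\<^esub>"
proof
  fix i show "v i = \<one>\<^bsub>Z2pow (k - 1)\<^esub> i"
  proof (cases "i < k - 1")
    case True
    then have "v i \<in> {0..<2}" using v unfolding Z2pow_carrier by (blast dest: PiE_mem)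
    moreover have "Suc i \<in> {1..k}" "Suc i < k" using True by auto
    then have "v i \<noteq> 1" using assms(2)[of "Suc i"] by (simp add: zsign_def)
    ultimately show ?thesis using True by (auto simp: Z2pow_def)
  next
    case False
    then show ?thesis using v by (auto simp: Z2pow_carrier Z2pow_def PiE_iff extensional_def)
  qed
qed

lemma zsign_surj:
  assumes "\<not> \<delta> k"
  shows "\<exists>v\<in>carrier (Z2pow (k - 1)). \<forall>i\<in>{1..k}. zsign k v i = \<delta> i"
proof (intro bexI[of _ "\<lambda>i\<in>{..<k - 1}. if \<delta> (Suc i) then 1 else 0"] ballI)
  fix i assume "i \<in> {1..k}"
  with assms show "zsign k (\<lambda>i\<in>{..<k - 1}. if \<delta> (Suc i) then 1 else 0) i = \<delta> i"
    by (cases "i = k") (auto simp: zsign_def)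
qed (auto simp: Z2pow_carrier)

text \<open>Conjugation by \<open>kt\<close> reverses all signs at once, so it can be used to clear
  the sign of the last generator; what remains is in the chosen complement.\<close>

lemma saut_sign_decomp:
  shows "\<exists>g\<in>Inn (KG k). \<exists>v\<in>carrier (Z2pow (k - 1)).
    saut k id \<delta> = g \<otimes>\<^bsub>AutoGroup (KG k)\<^esub> saut k id (zsign k v)"
proof -
  interpret K: group "KG k" by (rule group_KG)
  interpret A: group "AutoGroup (KG k)" by (rule K.AutoGroup)
  have id: "id permutes {1..k}" by (rule permutes_id)
  obtain v where v: "v \<in> carrier (Z2pow (k - 1))" "\<forall>i\<in>{1..k}. zsign k v i = (\<delta> i \<noteq> \<delta> k)"
    using zsign_surj[of "\<lambda>i. \<delta> i \<noteq> \<delta> k" k] by blast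
  define g where "g = (if \<delta> k then kt else \<one>\<^bsub>KG k\<^esub>)"
  have g: "inner (KG k) g = saut k id (\<lambda>_. \<delta> k)"
    by (simp add: g_def inner_kt K.inner_one saut_id)
  have "saut k id \<delta> = inner (KG k) g \<otimes>\<^bsub>AutoGroup (KG k)\<^esub> saut k id (zsign k v)"
    unfolding g saut_mult[OF id id] id_comp by (rule saut_cong[OF id]) (use v in auto)
  moreover have "inner (KG k) g \<in> Inn (KG k)" by (auto simp: Inn_eq g_def)
  ultimately show ?thesis using v(1) by blast
qed

text \<open>\<open>L\<close> is an isomorphic copy of \<open>KG k\<close>, so that the presented
  group itself, rather than \<open>Inn (KG k)\<close>, becomes the bottom factor. The bound on
  \<open>k\<close> guarantees a trivial centre; \<open>KG 0\<close> has order two.\<close>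

lemma AutoGroup_KG:
  assumes k: "k \<ge> 1" and L: "group L" "L \<cong> KG k"
  shows "\<exists>\<phi> \<psi>. \<phi> \<in> hom (Z2pow (k - 1)) (AutoGroup L) \<and>
      \<psi> \<in> hom (sym_group k) (AutoGroup (semidirect_product L (Z2pow (k - 1)) \<phi>)) \<and>
      AutoGroup (KG k) \<cong> semidirect_product (semidirect_product L (Z2pow (k - 1)) \<phi>) (sym_group k) \<psi>"
    and "\<exists>\<chi>. \<chi> \<in> hom (sym_group k) (AutoGroup (Z2pow (k - 1))) \<and>
      OutGroup (KG k) \<cong> semidirect_product (Z2pow (k - 1)) (sym_group k) \<chi>"
    and "L \<cong> (AutoGroup (KG k))\<lparr>carrier := Inn (KG k)\<rparr>"
proof -
  interpret K: group "KG k" by (rule group_KG)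
  interpret A: group "AutoGroup (KG k)" by (rule K.AutoGroup)
  let ?A = "AutoGroup (KG k)"
  have id: "id permutes {1..k}" by (rule permutes_id)
  have k': "k \<in> {1..k}" using k by simp
  obtain \<theta> where \<theta>: "\<theta> \<in> iso L (KG k)" using L(2) by (auto simp: is_iso_def)
  have \<theta>_bij: "bij_betw \<theta> (carrier L) (carrier (KG k))" using \<theta> by (simp add: iso_def)
  have inner_inj: "inj_on (inner (KG k)) (carrier (KG k))"
  proof -
    interpret i: group_hom "KG k" ?A "inner (KG k)"
      by (simp add: K.inner_hom group_hom.intro group_hom_axioms.intro K.is_group A.is_group)
    show ?thesis unfolding i.inj_on_one_iff
    proof (intro allI impI)
      fix g assume g: "g \<in> carrier (KG k)" "inner (KG k) g = \<one>\<^bsub>?A\<^esub>"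
      \<comment> \<open>The identity has no sign at the index \<open>k\<close>, which rules out
        \<open>g = kt\<close>.\<close>
      from saut_eq_inner[OF g(1) id g(2)[folded saut_one]] k' show "g = \<one>\<^bsub>KG k\<^esub>" by blast
    qed
  qed
  let ?j = "inner (KG k) \<circ> \<theta>"
  have \<theta>_img: "\<theta> ` carrier L = carrier (KG k)" using \<theta>_bij by (simp add: bij_betw_def)
  have j: "?j \<in> hom L ?A" "inj_on ?j (carrier L)" "?j ` carrier L = Inn (KG k)"
  proof -
    show "?j \<in> hom L ?A" using \<theta> K.inner_hom by (auto simp: iso_def intro: Group.hom_compose)
    show "inj_on ?j (carrier L)"
      using \<theta>_bij inner_inj by (intro comp_inj_on) (simp_all add: bij_betw_def)
    show "?j ` carrier L = Inn (KG k)" unfolding image_comp[symmetric] \<theta>_img Inn_eq ..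
  qed
  show "L \<cong> (AutoGroup (KG k))\<lparr>carrier := Inn (KG k)\<rparr>"
    by (rule is_isoI[of ?j]) (use j in \<open>auto simp: iso_def hom_def bij_betw_def\<close>)
  define e where "e v = saut k id (zsign k v)" for v
  define s where "s p = saut k p (\<lambda>_. False)" for p
  have ea: "e v \<in> carrier ?A" for v by (simp add: e_def AutoGroup_carrier saut_auto[OF id])
  have sa: "s p \<in> carrier ?A" if "p \<in> carrier (sym_group k)" for p
    using that by (simp add: s_def AutoGroup_carrier saut_auto sym_group_carrier)
  have e: "e \<in> hom (Z2pow (k - 1)) ?A"
  proof (rule homI)
    fix v w assume vw: "v \<in> carrier (Z2pow (k - 1))" "w \<in> carrier (Z2pow (k - 1))"
    have "zsign k (v \<otimes>\<^bsub>Z2pow (k - 1)\<^esub> w) = (\<lambda>i. zsign k w i \<noteq> zsign k v (id i))"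
      unfolding zsign_mult[OF vw, THEN ext] id_apply by auto
    then show "e (v \<otimes>\<^bsub>Z2pow (k - 1)\<^esub> w) = e v \<otimes>\<^bsub>?A\<^esub> e w"
      unfolding e_def saut_mult[OF id id] by simp
  qed (rule ea)
  have s: "s \<in> hom (sym_group k) ?A"
    by (rule homI) (use sa in \<open>auto simp: s_def saut_mult sym_group_carrier sym_group_mult\<close>)
  have saut_unique: "\<sigma> = id \<and> (\<forall>i\<in>{1..k}. \<epsilon> i = \<epsilon> k)"
    if \<sigma>: "\<sigma> permutes {1..k}" and g: "g \<in> Inn (KG k)" "g = saut k \<sigma> \<epsilon>" for g \<sigma> \<epsilon>
  proof -
    obtain x where x: "x \<in> carrier (KG k)" "inner (KG k) x = saut k \<sigma> \<epsilon>"
      using g unfolding Inn_eq by blast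
    show ?thesis using saut_eq_inner[OF x(1) \<sigma> x(2)] k' by blast
  qed
  have e_Inn: "v = \<one>\<^bsub>Z2pow (k - 1)\<^esub>" if v: "v \<in> carrier (Z2pow (k - 1))" "e v \<in> Inn (KG k)" for v
  proof (rule zsign_trivial[OF v(1)])
    have "\<not> zsign k v k" by (simp add: zsign_def)
    then show "\<not> zsign k v i" if "i \<in> {1..k}" for i
      using saut_unique[OF id v(2) e_def] that by blast
  qed
  have s_e: "p = \<one>\<^bsub>sym_group k\<^esub>"
    if g: "g \<in> Inn (KG k)" and v: "v \<in> carrier (Z2pow (k - 1))" and p: "p \<in> carrier (sym_group k)"
      and eq: "g \<otimes>\<^bsub>?A\<^esub> e v = s p" for g v p
  proof -
    have p': "p permutes {1..k}" using p by (simp add: sym_group_carrier)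
    have gc: "g \<in> carrier ?A" using g K.Inn_normal[THEN normal_imp_subgroup, THEN subgroup.subset] by blast
    \<comment> \<open>A sign change is its own inverse, so \<open>g\<close> is a signed permutation
      with underlying permutation \<open>p\<close>; being inner, it forces
      \<open>p = id\<close>.\<close>
    have "e v \<otimes>\<^bsub>?A\<^esub> e v = \<one>\<^bsub>?A\<^esub>"
      unfolding e_def saut_mult[OF id id] by (simp add: saut_one)
    then have "g = s p \<otimes>\<^bsub>?A\<^esub> e v"
      unfolding eq[symmetric] using gc ea by (simp add: A.m_assoc)
    also have "\<dots> = saut k (p \<circ> id) (\<lambda>i. zsign k v i \<noteq> False)"
      unfolding e_def s_def saut_mult[OF p' id] ..
    finally have "g = saut k p (zsign k v)" by simp
    then have "p = id" using saut_unique[OF p' g] by blast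
    then show ?thesis by (simp only: sym_group_one)
  qed
  have conj: "\<exists>g\<in>Inn (KG k). \<exists>w\<in>carrier (Z2pow (k - 1)).
      s p \<otimes>\<^bsub>?A\<^esub> e v \<otimes>\<^bsub>?A\<^esub> inv\<^bsub>?A\<^esub> s p = g \<otimes>\<^bsub>?A\<^esub> e w"
    if v: "v \<in> carrier (Z2pow (k - 1))" and p: "p \<in> carrier (sym_group k)" for v p
  proof -
    have p': "p permutes {1..k}" using p by (simp add: sym_group_carrier)
    \<comment> \<open>Conjugation by a permutation moves the signs along with the indices. The moved
      signs may include one at \<open>k\<close> and so leave the complement; correcting this
      introduces the inner factor.\<close>
    let ?\<delta> = "zsign k v \<circ> inv_into UNIV p"
    have "saut k id ?\<delta> \<otimes>\<^bsub>?A\<^esub> s p = s p \<otimes>\<^bsub>?A\<^esub> e v"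
      unfolding s_def e_def saut_mult[OF id p'] saut_mult[OF p' id]
      by (simp add: permutes_inverses[OF p'])
    then have "s p \<otimes>\<^bsub>?A\<^esub> e v \<otimes>\<^bsub>?A\<^esub> inv\<^bsub>?A\<^esub> s p = saut k id ?\<delta>"
      using A.inv_solve_right'[of "saut k id ?\<delta>" "s p \<otimes>\<^bsub>?A\<^esub> e v" "s p"]
        sa[OF p] ea[of v] saut_auto[OF id, of ?\<delta>] A.m_closed[OF sa[OF p] ea[of v]]
      unfolding AutoGroup_carrier by simp
    then show ?thesis using saut_sign_decomp[of k ?\<delta>] unfolding e_def by metis
  qed
  have gen: "\<exists>g\<in>Inn (KG k). \<exists>v\<in>carrier (Z2pow (k - 1)). \<exists>p\<in>carrier (sym_group k).
      a = g \<otimes>\<^bsub>?A\<^esub> e v \<otimes>\<^bsub>?A\<^esub> s p" if a: "a \<in> carrier ?A" for a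
  proof -
    obtain x \<sigma> \<epsilon> where x: "x \<in> carrier (KG k)" "\<sigma> permutes {1..k}" "a = inner (KG k) x \<otimes>\<^bsub>?A\<^esub> saut k \<sigma> \<epsilon>"
      using auto_KG_cases[OF a[unfolded AutoGroup_carrier]] .
    \<comment> \<open>Here the permutation acts first, so the signs have to be read at the new
      indices.\<close>
    let ?\<delta> = "\<epsilon> \<circ> inv_into UNIV \<sigma>"
    have \<sigma>\<epsilon>: "saut k \<sigma> \<epsilon> = saut k id ?\<delta> \<otimes>\<^bsub>?A\<^esub> s \<sigma>"
      unfolding s_def saut_mult[OF id x(2)] by (simp add: permutes_inverses[OF x(2)])
    obtain g v where gv: "g \<in> Inn (KG k)" "v \<in> carrier (Z2pow (k - 1))"
      "saut k id ?\<delta> = g \<otimes>\<^bsub>?A\<^esub> e v"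
      using saut_sign_decomp[of k ?\<delta>] unfolding e_def by blast
    have sub: "subgroup (Inn (KG k)) ?A" by (rule normal_imp_subgroup[OF K.Inn_normal])
    have xI: "inner (KG k) x \<in> Inn (KG k)" using x(1) by (auto simp: Inn_eq)
    have \<sigma>: "\<sigma> \<in> carrier (sym_group k)" using x(2) by (simp add: sym_group_carrier)
    have c: "inner (KG k) x \<in> carrier ?A" "g \<in> carrier ?A"
      using subgroup.mem_carrier[OF sub] xI gv(1) by blast+
    have "a = (inner (KG k) x \<otimes>\<^bsub>?A\<^esub> g) \<otimes>\<^bsub>?A\<^esub> e v \<otimes>\<^bsub>?A\<^esub> s \<sigma>"
      unfolding x(3) \<sigma>\<epsilon> gv(3) using c ea[of v] sa[OF \<sigma>] by (simp only: A.m_assoc A.m_closed)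
    then show ?thesis using subgroup.m_closed[OF sub xI gv(1)] gv(2) \<sigma> by blast
  qed
  note tower = normal_tower_semidirect[OF A.is_group K.Inn_normal L(1) group_Z2pow sym_group_is_group
      j e s e_Inn s_e conj gen]
  show "\<exists>\<phi> \<psi>. \<phi> \<in> hom (Z2pow (k - 1)) (AutoGroup L) \<and>
      \<psi> \<in> hom (sym_group k) (AutoGroup (semidirect_product L (Z2pow (k - 1)) \<phi>)) \<and>
      AutoGroup (KG k) \<cong> semidirect_product (semidirect_product L (Z2pow (k - 1)) \<phi>) (sym_group k) \<psi>"
    by (rule tower(1))
  show "\<exists>\<chi>. \<chi> \<in> hom (sym_group k) (AutoGroup (Z2pow (k - 1))) \<and>
      OutGroup (KG k) \<cong> semidirect_product (Z2pow (k - 1)) (sym_group k) \<chi>"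
    unfolding OutGroup_def by (rule tower(2))
qed

text \<open>With one generator the only permutation is the identity, and the only nontrivial sign
  change is the simultaneous one, hence inner. The group is S_3.\<close>

lemma Inn_KG_1: "Inn (KG 1) = carrier (AutoGroup (KG 1))"
proof
  interpret K: group "KG 1" by (rule group_KG)
  interpret A: group "AutoGroup (KG 1)" by (rule K.AutoGroup)
  have sub: "subgroup (Inn (KG 1)) (AutoGroup (KG 1))" by (rule normal_imp_subgroup[OF K.Inn_normal])
  show "Inn (KG 1) \<subseteq> carrier (AutoGroup (KG 1))" by (rule subgroup.subset[OF sub])
  show "carrier (AutoGroup (KG 1)) \<subseteq> Inn (KG 1)"
  proof
    fix a assume a: "a \<in> carrier (AutoGroup (KG 1))"
    obtain x \<sigma> \<epsilon> where x: "x \<in> carrier (KG 1)" "\<sigma> permutes {1..1}"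
      "a = inner (KG 1) x \<otimes>\<^bsub>AutoGroup (KG 1)\<^esub> saut 1 \<sigma> \<epsilon>"
      using auto_KG_cases[OF a[unfolded AutoGroup_carrier]] .
    have \<sigma>: "\<sigma> = id" using x(2) by simp
    have "saut 1 id \<epsilon> = saut 1 id (\<lambda>_. \<epsilon> 1)"
      by (rule saut_cong) (simp_all add: permutes_id)
    also have "\<dots> = inner (KG 1) (if \<epsilon> 1 then kt else \<one>\<^bsub>KG 1\<^esub>)"
      by (simp add: inner_kt saut_id group.inner_one[OF group_KG])
    finally have "saut 1 \<sigma> \<epsilon> \<in> Inn (KG 1)"
      unfolding \<sigma> Inn_eq by (rule image_eqI) (simp del: One_nat_def)
    moreover have "inner (KG 1) x \<in> Inn (KG 1)" using x(1) by (auto simp: Inn_eq)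
    ultimately show "a \<in> Inn (KG 1)" unfolding x(3) by (intro subgroup.m_closed[OF sub])
  qed
qed

theorem theorem5p5:
  shows "AutoGroup (Lgroup 3) \<cong> Lgroup 3 \<and> trivial_group (OutGroup (Lgroup 3)) \<and>
    (\<forall>n::nat. n \<ge> 4 \<longrightarrow>
      (\<exists>\<phi> \<psi>. \<phi> \<in> hom (Z2pow (n - 3)) (AutoGroup (Lgroup n)) \<and>
              \<psi> \<in> hom (sym_group (n - 2))
                      (AutoGroup (semidirect_product (Lgroup n) (Z2pow (n - 3)) \<phi>)) \<and>
              AutoGroup (Lgroup n) \<cong>
                semidirect_product (semidirect_product (Lgroup n) (Z2pow (n - 3)) \<phi>)
                                   (sym_group (n - 2)) \<psi>) \<and>
      (\<exists>\<chi>. \<chi> \<in> hom (sym_group (n - 2)) (AutoGroup (Z2pow (n - 3))) \<and>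
           OutGroup (Lgroup n) \<cong> semidirect_product (Z2pow (n - 3)) (sym_group (n - 2)) \<chi>))"
proof (intro conjI allI impI)
  have Aut: "AutoGroup (Lgroup n) \<cong> AutoGroup (KG (n - 2))" if n2: "n \<ge> 2" for n
  proof -
    obtain \<theta> where "\<theta> \<in> iso (Lgroup n) (KG (n - 2))"
      using Lgroup_iso_KG[OF n2] by (auto simp: is_iso_def)
    then obtain \<Theta> where "\<Theta> \<in> iso (AutoGroup (Lgroup n)) (AutoGroup (KG (n - 2)))"
      using group.AutoGroup_iso[OF group_Lgroup group_KG] by metis
    then show ?thesis by (rule is_isoI)
  qed
  have Out: "OutGroup (Lgroup n) \<cong> OutGroup (KG (n - 2))" if "n \<ge> 2" for n
    by (rule group.OutGroup_iso[OF group_Lgroup group_KG Lgroup_iso_KG[OF that]])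
  have L3: "Lgroup 3 \<cong> KG 1" using Lgroup_iso_KG[of 3] by simp
  interpret K: group "KG 1" by (rule group_KG)
  interpret A: group "AutoGroup (KG 1)" by (rule K.AutoGroup)
  interpret L: group "Lgroup 3" by (rule group_Lgroup)
  \<comment> \<open>The trivial centre identifies \<open>Lgroup 3\<close> with the inner
    automorphisms of \<open>KG 1\<close>, and these are all automorphisms.\<close>
  have "Lgroup 3 \<cong> AutoGroup (KG 1)"
    using AutoGroup_KG(3)[OF order_refl group_Lgroup L3] unfolding Inn_KG_1 by simp
  moreover have "AutoGroup (Lgroup 3) \<cong> AutoGroup (KG 1)" using Aut[of 3] by simp
  ultimately show "AutoGroup (Lgroup 3) \<cong> Lgroup 3"
    using L.iso_sym iso_trans by blast
  have "trivial_group (OutGroup (KG 1))"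
  proof -
    interpret N: normal "carrier (AutoGroup (KG 1))" "AutoGroup (KG 1)"
      using K.Inn_normal unfolding Inn_KG_1 .
    have "group (OutGroup (KG 1))" unfolding OutGroup_def Inn_KG_1 by (rule N.factorgroup_is_group)
    moreover have "carrier (OutGroup (KG 1)) = {\<one>\<^bsub>OutGroup (KG 1)\<^esub>}"
      unfolding OutGroup_def Inn_KG_1 carrier_FactGroup one_FactGroup
      using A.coset_join2[OF _ A.subgroup_self] A.one_closed by blast
    ultimately show ?thesis unfolding trivial_group_def ..
  qed
  moreover have "group (OutGroup (Lgroup 3))"
    unfolding OutGroup_def by (rule normal.factorgroup_is_group[OF L.Inn_normal])
  moreover have "OutGroup (KG 1) \<cong> OutGroup (Lgroup 3)"
    using group.iso_sym[OF \<open>group (OutGroup (Lgroup 3))\<close>] Out[of 3] by simp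
  ultimately show "trivial_group (OutGroup (Lgroup 3))"
    using isomorphic_group_triviality1 by blast
  fix n :: nat assume n: "n \<ge> 4"
  then have k: "1 \<le> n - 2" "n - 2 - 1 = n - 3" "2 \<le> n" by auto
  note KG = AutoGroup_KG[OF k(1) group_Lgroup Lgroup_iso_KG[OF k(3)], unfolded k(2)]
  show "\<exists>\<phi> \<psi>. \<phi> \<in> hom (Z2pow (n - 3)) (AutoGroup (Lgroup n)) \<and>
      \<psi> \<in> hom (sym_group (n - 2)) (AutoGroup (semidirect_product (Lgroup n) (Z2pow (n - 3)) \<phi>)) \<and>
      AutoGroup (Lgroup n) \<cong>
        semidirect_product (semidirect_product (Lgroup n) (Z2pow (n - 3)) \<phi>) (sym_group (n - 2)) \<psi>"
    using KG(1) iso_trans[OF Aut[OF k(3)]] by blast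
  show "\<exists>\<chi>. \<chi> \<in> hom (sym_group (n - 2)) (AutoGroup (Z2pow (n - 3))) \<and>
      OutGroup (Lgroup n) \<cong> semidirect_product (Z2pow (n - 3)) (sym_group (n - 2)) \<chi>"
    using KG(2) iso_trans[OF Out[OF k(3)]] by blast
qed

end
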